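(* Let $g \geq 0$ be a constant integer, and let $m=m(n)$ be an integer-valued function satisfying $0 < \liminf \frac{m}{n} \leq \limsup \frac{m}{n} < 1$. Then there are constants $0<c\le C$ such that with probability tending to $1$ as $n\to\infty$, $cn\le F(S_{g}(n,m)) \le Cn$.
   Context: A graph has genus at most $g$ if it can be embedded without crossing edges on an orientable surface of genus $g$. $\mathcal{S}^{g}(n,m)$ is the set of labelled simple graphs on $[n]$ with exactly $m$ edges and genus at most $g$; $S_{g}(n,m)$ is chosen uniformly at random from it. For a given embedding, the size of a face is the number of edges having a side in the face, counting an edge twice if both sides lie in the face. $F(G)$ is the largest face size of $G$, maximised over all embeddings of $G$ on orientable surfaces of genus at most $g$. *)

theory Defs
  imports "HOL-Analysis.Analysis" "HOL-Probability.Probability"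
begin

section \<open>The closed orientable surface of genus \<open>g\<close>\<close>

text \<open>
  For \<open>g > 0\<close> the surface is the quotient of a \<open>4g\<close>-gon by the boundary word
  \<open>a\<^sub>1 b\<^sub>1 a\<^sub>1\<inverse> b\<^sub>1\<inverse> \<dots> a\<^sub>g b\<^sub>g a\<^sub>g\<inverse> b\<^sub>g\<inverse>\<close>; for \<open>g = 0\<close> it is the sphere, obtained from the
  boundary word \<open>a a\<inverse>\<close>. The polygon is the closed unit disc, its \<open>j\<close>-th side being the arc
  \<open>{polygon_point g s | j \<le> s \<le> j + 1}\<close>.
\<close>

definition polygon_point :: "nat \<Rightarrow> real \<Rightarrow> complex" where
  "polygon_point g s = cis (2 * pi * s / (4 * real g))"

inductive side_glue :: "nat \<Rightarrow> complex \<Rightarrow> complex \<Rightarrow> bool" for g :: nat where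
  sphere: "g = 0 \<Longrightarrow> norm z = 1 \<Longrightarrow> side_glue g z (cnj z)"
| side_a: "k < g \<Longrightarrow> 0 \<le> t \<Longrightarrow> t \<le> 1 \<Longrightarrow>
    side_glue g (polygon_point g (4 * real k + t)) (polygon_point g (4 * real k + 3 - t))"
| side_b: "k < g \<Longrightarrow> 0 \<le> t \<Longrightarrow> t \<le> 1 \<Longrightarrow>
    side_glue g (polygon_point g (4 * real k + 1 + t)) (polygon_point g (4 * real k + 4 - t))"

definition glue_rel :: "nat \<Rightarrow> (complex \<times> complex) set" where
  "glue_rel g = {(z, w). z \<in> cball 0 1 \<and> w \<in> cball 0 1 \<and> equivclp (side_glue g) z w}"

definition genus_surface :: "nat \<Rightarrow> complex set topology" where
  "genus_surface g =
     topology (\<lambda>U. U \<subseteq> cball 0 1 // glue_rel g \<and> openin (top_of_set (cball 0 1)) (\<Union>U))"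

lemma equiv_glue_rel: "equiv (cball 0 1) (glue_rel g)"
  unfolding glue_rel_def
  by (rule equivI) (auto simp: refl_on_def sym_def trans_def equivclp_sym equivclp_def
      intro: rtranclp_trans dest: equivclp_sym[unfolded equivclp_def])

lemma openin_genus_surface:
  "openin (genus_surface g) U \<longleftrightarrow>
     U \<subseteq> cball 0 1 // glue_rel g \<and> openin (top_of_set (cball 0 1)) (\<Union>U)"
proof -
  have "istopology (\<lambda>U. U \<subseteq> cball 0 1 // glue_rel g \<and> openin (top_of_set (cball 0 1)) (\<Union>U))"
    unfolding istopology_def
  proof (intro conjI allI impI)
    fix U V :: "complex set set"
    assume "U \<subseteq> cball 0 1 // glue_rel g \<and> openin (top_of_set (cball 0 1)) (\<Union>U)"
      and "V \<subseteq> cball 0 1 // glue_rel g \<and> openin (top_of_set (cball 0 1)) (\<Union>V)"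
    then have U: "U \<subseteq> cball 0 1 // glue_rel g" and oU: "openin (top_of_set (cball 0 1)) (\<Union>U)"
      and V: "V \<subseteq> cball 0 1 // glue_rel g" and oV: "openin (top_of_set (cball 0 1)) (\<Union>V)"
      by auto
    show "U \<inter> V \<subseteq> cball 0 1 // glue_rel g" using U by blast
    have "\<Union>(U \<inter> V) = \<Union>U \<inter> \<Union>V"
      using U V quotient_disj[OF equiv_glue_rel] by blast
    then show "openin (top_of_set (cball 0 1)) (\<Union>(U \<inter> V))"
      using oU oV by (simp add: openin_Int)
  next
    fix K :: "complex set set set"
    assume K: "\<forall>U\<in>K. U \<subseteq> cball 0 1 // glue_rel g \<and> openin (top_of_set (cball 0 1)) (\<Union>U)"
    show "\<Union>K \<subseteq> cball 0 1 // glue_rel g" using K by blast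
    have "\<Union>(\<Union>K) = \<Union>(Union ` K)" by blast
    then show "openin (top_of_set (cball 0 1)) (\<Union>(\<Union>K))"
      using K by (metis (mono_tags, lifting) imageE openin_Union)
  qed
  then show ?thesis
    by (simp add: genus_surface_def)
qed

lemma quotient_map_genus_surface:
  "quotient_map (top_of_set (cball 0 1)) (genus_surface g) (\<lambda>z. glue_rel g `` {z})"
proof -
  let ?C = "cball 0 1 :: complex set"
  have pre: "{z \<in> ?C. glue_rel g `` {z} \<in> U} = \<Union>U" if U: "U \<subseteq> ?C // glue_rel g" for U
  proof (intro equalityI subsetI)
    fix z assume "z \<in> {z \<in> ?C. glue_rel g `` {z} \<in> U}"
    then show "z \<in> \<Union>U" using equiv_class_self[OF equiv_glue_rel] by blast
  next
    fix z assume "z \<in> \<Union>U"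
    then obtain A where A: "A \<in> U" "z \<in> A" by blast
    then obtain w where w: "w \<in> ?C" "A = glue_rel g `` {w}" using U by (auto simp: quotient_def)
    then have "(w, z) \<in> glue_rel g" using A by blast
    then have "A = glue_rel g `` {z}" "z \<in> ?C"
      using w equiv_class_eq[OF equiv_glue_rel] by (auto simp: glue_rel_def)
    then show "z \<in> {z \<in> ?C. glue_rel g `` {z} \<in> U}" using A by blast
  qed
  have "\<Union>(?C // glue_rel g) = ?C" by (rule Union_quotient[OF equiv_glue_rel])
  then have "openin (genus_surface g) (?C // glue_rel g)"
    by (simp add: openin_genus_surface)
  then have top: "topspace (genus_surface g) = ?C // glue_rel g"
    by (meson openin_genus_surface openin_subset openin_topspace subset_antisym)
  show ?thesis
    unfolding quotient_map_def
  proof (intro conjI allI impI)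
    show "(\<lambda>z. glue_rel g `` {z}) ` topspace (top_of_set ?C) = topspace (genus_surface g)"
      by (auto simp: top quotient_def)
  next
    fix U assume "U \<subseteq> topspace (genus_surface g)"
    then have "U \<subseteq> ?C // glue_rel g" by (simp add: top)
    then show "openin (top_of_set ?C) {x \<in> topspace (top_of_set ?C). glue_rel g `` {x} \<in> U} =
        openin (genus_surface g) U"
      using pre[of U] by (simp only: topspace_euclidean_subtopology openin_genus_surface) simp
  qed
qed

section \<open>Embeddings of graphs on surfaces\<close>

text \<open>
  A graph on \<open>{1..n}\<close> is given by its edge set \<open>E\<close>. An embedding consists of a placement \<open>p\<close> of
  the vertices and, for each edge \<open>e\<close>, a parametrised simple arc \<open>c e\<close> on \<open>{0..1}\<close>.
\<close>

definition labelled_graphs :: "nat \<Rightarrow> nat \<Rightarrow> nat set set set" where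
  "labelled_graphs n m = {E. E \<subseteq> {e. e \<subseteq> {1..n} \<and> card e = 2} \<and> card E = m}"

definition drawing ::
  "nat \<Rightarrow> nat set set \<Rightarrow> (nat \<Rightarrow> 'a) \<Rightarrow> (nat set \<Rightarrow> real \<Rightarrow> 'a) \<Rightarrow> 'a set" where
  "drawing n E p c = p ` {1..n} \<union> (\<Union>e\<in>E. c e ` {0..1})"

definition embedding_on ::
  "'a topology \<Rightarrow> nat \<Rightarrow> nat set set \<Rightarrow> (nat \<Rightarrow> 'a) \<Rightarrow> (nat set \<Rightarrow> real \<Rightarrow> 'a) \<Rightarrow> bool" where
  "embedding_on X n E p c \<longleftrightarrow>
     inj_on p {1..n} \<and> p ` {1..n} \<subseteq> topspace X \<and>
     (\<forall>e\<in>E. embedding_map (top_of_set {0..1}) X (c e) \<and>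
            {c e 0, c e 1} = p ` e \<and> c e ` {0<..<1} \<inter> p ` {1..n} = {}) \<and>
     (\<forall>e\<in>E. \<forall>e'\<in>E. e \<noteq> e' \<longrightarrow> c e ` {0<..<1} \<inter> c e' ` {0<..<1} = {})"

definition genus_at_most :: "nat \<Rightarrow> nat \<Rightarrow> nat set set \<Rightarrow> bool" where
  "genus_at_most g n E \<longleftrightarrow> (\<exists>p c. embedding_on (genus_surface g) n E p c)"

definition genus_graphs :: "nat \<Rightarrow> nat \<Rightarrow> nat \<Rightarrow> nat set set set" where
  "genus_graphs g n m = {E \<in> labelled_graphs n m. genus_at_most g n E}"

section \<open>Faces and their sizes\<close>

definition embedding_faces ::
  "'a topology \<Rightarrow> nat \<Rightarrow> nat set set \<Rightarrow> (nat \<Rightarrow> 'a) \<Rightarrow> (nat set \<Rightarrow> real \<Rightarrow> 'a) \<Rightarrow> 'a set set" where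
  "embedding_faces X n E p c =
     connected_components_of (subtopology X (topspace X - drawing n E p c))"

text \<open>
  A chart (parametrised by the open unit disc) around an inner point of the arc \<open>a\<close> in which the
  drawing \<open>D\<close> appears precisely as the horizontal diameter. The open upper and lower half discs
  are then the two sides of \<open>a\<close>.
\<close>

definition side_chart :: "'a topology \<Rightarrow> 'a set \<Rightarrow> (real \<Rightarrow> 'a) \<Rightarrow> (complex \<Rightarrow> 'a) \<Rightarrow> bool" where
  "side_chart X D a h \<longleftrightarrow>
     embedding_map (top_of_set (ball 0 1)) X h \<and> openin X (h ` ball 0 1) \<and>
     h ` {z \<in> ball 0 1. Im z = 0} = h ` ball 0 1 \<inter> D \<and>
     h ` {z \<in> ball 0 1. Im z = 0} \<subseteq> a ` {0<..<1}"

text \<open>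
  The number of sides of \<open>a\<close> lying in the face \<open>f\<close>. Along an edge each side stays in the same
  face, so that any single chart decides; reflecting a chart exchanges the two half discs.
\<close>

definition sides_in :: "'a topology \<Rightarrow> 'a set \<Rightarrow> (real \<Rightarrow> 'a) \<Rightarrow> 'a set \<Rightarrow> nat" where
  "sides_in X D a f =
     (if \<exists>h. side_chart X D a h \<and> h ` {z \<in> ball 0 1. Im z \<noteq> 0} \<subseteq> f then 2
      else if \<exists>h. side_chart X D a h \<and> h ` {z \<in> ball 0 1. Im z > 0} \<subseteq> f then 1
      else 0)"

definition face_size ::
  "'a topology \<Rightarrow> nat \<Rightarrow> nat set set \<Rightarrow> (nat \<Rightarrow> 'a) \<Rightarrow> (nat set \<Rightarrow> real \<Rightarrow> 'a) \<Rightarrow> 'a set \<Rightarrow> nat" where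
  "face_size X n E p c f = (\<Sum>e\<in>E. sides_in X (drawing n E p c) (c e) f)"

definition face_sizes :: "nat \<Rightarrow> nat \<Rightarrow> nat set set \<Rightarrow> nat set" where
  "face_sizes g n E =
     {face_size (genus_surface h) n E p c f | h p c f.
        h \<le> g \<and> embedding_on (genus_surface h) n E p c \<and>
        f \<in> embedding_faces (genus_surface h) n E p c}"

definition largest_face :: "nat \<Rightarrow> nat \<Rightarrow> nat set set \<Rightarrow> nat" where
  "largest_face g n E = Max (face_sizes g n E)"

lemma face_size_le: "face_size X n E p c f \<le> 2 * card E"
proof -
  have "face_size X n E p c f \<le> (\<Sum>e\<in>E. 2)"
    unfolding face_size_def by (rule sum_mono) (simp add: sides_in_def)
  then show ?thesis by simp
qed

lemma finite_face_sizes: "finite (face_sizes g n E)"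
  by (rule finite_subset[of _ "{..2 * card E}"]) (auto simp: face_sizes_def face_size_le)

end

theory Submission
  imports Defs
begin

text \<open>
  If \<open>G\<close> splits into vertex-disjoint parts \<open>R\<close> and \<open>F\<close> with \<open>F\<close> a forest, then \<open>R\<close> keeps its
  embedding and \<open>F\<close> is redrawn with straight segments in a small open disc that avoids \<open>R\<close>. The
  complement of a straight forest in the plane is connected by Janiszewski's theorem, so both sides
  of every edge of \<open>F\<close> lie in one face and the largest face of \<open>G\<close> has size at least \<open>2 card F\<close>.

  Every graph has such a splitting with \<open>card F \<ge> card (\<Union>G) - card G\<close>. As \<open>m \<le> (1 - \<delta>) n\<close>, the
  largest face is therefore linear in \<open>n\<close> unless \<open>G\<close> has at least \<open>\<delta> n / 2\<close> isolated vertices. It is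
  also linear if \<open>G\<close> has linearly many isolated edges. Graphs with many isolated vertices and few
  isolated edges are exponentially rare: moving any of the \<open>m \<ge> \<delta> n\<close> edges to any pair of isolated
  vertices produces a graph of the same class, and since the moved edge is isolated in the new graph
  there are few ways to undo the move. Each of \<open>\<lfloor>c n\<rfloor>\<close> successive moves at least doubles the number
  of graphs. The upper bound holds because a face has size at most \<open>2 m\<close>.
\<close>

section \<open>Straight-line drawings of forests\<close>

text \<open>Only the new end \<open>v\<close> has to be fresh: \<open>u\<close> may be an old
  vertex, which attaches a leaf, or a new one, which starts a component. The inductive form supplies
  the leaf-by-leaf induction for drawings.\<close>

inductive forest :: "'v set set \<Rightarrow> bool" where
  empty: "forest {}"
| leaf: "forest F \<Longrightarrow> u \<noteq> v \<Longrightarrow> v \<notin> \<Union>F \<Longrightarrow> forest (insert {u, v} F)"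

lemma forest_finite: "forest F \<Longrightarrow> finite F"
  by (induction rule: forest.induct) auto

lemma forest_card2: "forest F \<Longrightarrow> e \<in> F \<Longrightarrow> card e = 2"
  by (induction rule: forest.induct) auto

lemma forest_finite_Union: "forest F \<Longrightarrow> finite (\<Union>F)"
  by (induction rule: forest.induct) auto

text \<open>Edges appear as convex hulls, so no orientation of an edge has to be chosen.\<close>

definition straight_set :: "('v \<Rightarrow> complex) \<Rightarrow> 'v set \<Rightarrow> 'v set set \<Rightarrow> complex set" where
  "straight_set q V F = q ` V \<union> (\<Union>e\<in>F. convex hull (q ` e))"

definition straight_drawing :: "('v \<Rightarrow> complex) \<Rightarrow> 'v set \<Rightarrow> 'v set set \<Rightarrow> bool" where
  "straight_drawing q V F \<longleftrightarrow>
     inj_on q V \<and>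
     (\<forall>e\<in>F. convex hull (q ` e) \<inter> q ` V \<subseteq> q ` e) \<and>
     (\<forall>e\<in>F. \<forall>e'\<in>F. e \<noteq> e' \<longrightarrow> convex hull (q ` e) \<inter> convex hull (q ` e') \<subseteq> q ` V)"

text \<open>The members of \<open>K\<close> through \<open>a\<close> occupy only finitely many
  directions at \<open>a\<close>, and the others keep a positive distance from \<open>a\<close>. A
  short segment in a fresh direction avoids both kinds.\<close>

lemma exists_free_segment:
  fixes a :: complex
  assumes "finite K" and cl: "\<And>S. S \<in> K \<Longrightarrow> closed S"
    and seg: "\<And>S. S \<in> K \<Longrightarrow> a \<in> S \<Longrightarrow> \<exists>b. S = closed_segment a b"
  obtains w where "w \<noteq> a" "\<And>S. S \<in> K \<Longrightarrow> closed_segment a w \<inter> S \<subseteq> {a}"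
proof -
  define K1 where "K1 = {S \<in> K. a \<in> S}"
  define K0 where "K0 = {S \<in> K. a \<notin> S}"
  obtain \<beta> where \<beta>: "\<And>S. S \<in> K1 \<Longrightarrow> S = closed_segment a (\<beta> S)"
    using seg unfolding K1_def by (metis (mono_tags, lifting) mem_Collect_eq)
  have "infinite (sphere (0::complex) 1)"
    by (intro uncountable_infinite connected_uncountable[of _ 1 "-1"] connected_sphere) auto
  moreover have "finite ((\<lambda>S. sgn (\<beta> S - a)) ` K1)"
    using \<open>finite K\<close> by (simp add: K1_def)
  ultimately obtain d where d: "norm d = 1" "d \<notin> (\<lambda>S. sgn (\<beta> S - a)) ` K1"
    by (metis dist_0_norm finite_subset mem_sphere subsetI)
  have "closed (\<Union>K0)" using \<open>finite K\<close> cl by (auto simp: K0_def)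
  moreover have "a \<notin> \<Union>K0" by (auto simp: K0_def)
  ultimately obtain r where r: "r > 0" "ball a r \<inter> \<Union>K0 = {}"
    by (metis Compl_iff disjoint_eq_subset_Compl open_Compl open_contains_ball)
  define w where "w = a + of_real (r/2) * d"
  show ?thesis
  proof
    show "w \<noteq> a" using d r by (auto simp: w_def)
    fix S assume S: "S \<in> K"
    have form: "\<exists>s. 0 < s \<and> s < r \<and> x = a + of_real s * d" if x: "x \<in> closed_segment a w" "x \<noteq> a" for x
    proof -
      obtain t where t: "0 \<le> t" "t \<le> 1" "x = (1 - t) *\<^sub>R a + t *\<^sub>R w"
        using x by (auto simp: in_segment)
      have x': "x = a + of_real (t * (r/2)) * d"
        by (simp add: t w_def scaleR_conv_of_real algebra_simps)
      moreover have "t \<noteq> 0" using x' x(2) by auto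
      moreover have "t * (r/2) < r"
        using t r mult_right_mono[of t 1 "r/2"] by simp
      ultimately show ?thesis using t r by (intro exI[of _ "t * (r/2)"]) auto
    qed
    show "closed_segment a w \<inter> S \<subseteq> {a}"
    proof (rule ccontr)
      assume "\<not> closed_segment a w \<inter> S \<subseteq> {a}"
      then obtain x where x: "x \<in> closed_segment a w" "x \<in> S" "x \<noteq> a" by auto
      obtain s where s: "0 < s" "s < r" "x = a + of_real s * d" using form x by blast
      show False
      proof (cases "a \<in> S")
        case True
        then have S1: "S \<in> K1" using S by (simp add: K1_def)
        then have "x \<in> closed_segment a (\<beta> S)" using \<beta> x by blast
        then obtain t where t: "0 \<le> t" "x = (1 - t) *\<^sub>R a + t *\<^sub>R \<beta> S"
          by (auto simp: in_segment)
        then have eq: "of_real s * d = of_real t * (\<beta> S - a)"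
          using s by (simp add: scaleR_conv_of_real algebra_simps)
        have "t \<noteq> 0" using eq s d by auto
        then have "sgn (t *\<^sub>R (\<beta> S - a)) = sgn (\<beta> S - a)"
          using t by (simp add: sgn_scaleR)
        moreover have "sgn (s *\<^sub>R d) = d"
          using s d by (simp add: sgn_scaleR) (simp add: sgn_div_norm)
        ultimately have "d = sgn (\<beta> S - a)" using eq by (simp add: scaleR_conv_of_real)
        then show False using d S1 by auto
      next
        case False
        then have "S \<in> K0" using S by (simp add: K0_def)
        moreover have "x \<in> ball a r" using s d by (simp add: dist_norm norm_mult)
        ultimately show False using r x by blast
      qed
    qed
  qed
qed

lemma closed_hull_finite: "finite e \<Longrightarrow> closed (convex hull (q ` e :: complex set))"
  by (simp add: compact_imp_closed finite_imp_compact_convex_hull)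

lemma closed_straight_set:
  "finite V \<Longrightarrow> finite F \<Longrightarrow> (\<And>e. e \<in> F \<Longrightarrow> finite e) \<Longrightarrow> closed (straight_set q V F)"
  unfolding straight_set_def
  by (intro closed_Un closed_UN ballI finite_imp_closed closed_hull_finite) auto

text \<open>A new leaf is drawn as a short segment that meets the old drawing only in
  \<open>q u\<close>. By Janiszewski's theorem the complement stays connected, since the two closed
  pieces have connected complements and meet in a single point.\<close>

lemma forest_drawing:
  assumes "forest F" "finite V" "\<Union>F \<subseteq> V"
  shows "\<exists>q. straight_drawing q V F \<and> connected (- straight_set q V F)"
  using assms
proof (induction arbitrary: V rule: forest.induct)
  case empty
  obtain q :: "'a \<Rightarrow> complex" where q: "inj_on q V"
    using inj_on_iff_card_le[of V "of_nat ` {..<card V}::complex set"]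
      card_image[of "of_nat :: nat \<Rightarrow> complex" "{..<card V}"] empty(1) by auto
  have "connected (- (q ` V))"
    using empty(1) by (intro path_connected_imp_connected path_connected_complement_countable) (auto simp: countable_finite)
  then show ?case using q by (auto simp: straight_drawing_def straight_set_def)
next
  case (leaf F u v)
  define V0 where "V0 = V - {v}"
  have V0: "finite V0" "\<Union>F \<subseteq> V0" "u \<in> V0" "v \<notin> V0" "V = insert v V0"
    using leaf by (auto simp: V0_def)
  from leaf.IH[OF V0(1,2)] obtain q where q: "straight_drawing q V0 F" "connected (- straight_set q V0 F)"
    by blast
  have eV0: "e \<subseteq> V0" if "e \<in> F" for e using V0 that by auto
  have finF: "finite F" "\<And>e. e \<in> F \<Longrightarrow> finite e"
    using leaf(1) forest_finite forest_card2 by (auto intro: card_ge_0_finite simp: forest_card2)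
  define K where "K = (\<lambda>x. {q x}) ` V0 \<union> (\<lambda>e. convex hull (q ` e)) ` F"
  have UK: "\<Union>K = straight_set q V0 F" by (auto simp: K_def straight_set_def)
  \<comment> \<open>The obstacles are the old vertices and edges. Those through \<open>q u\<close>
    are the point itself and the edges ending at \<open>u\<close>, all of them segments from
    \<open>q u\<close>.\<close>
  obtain w where w: "w \<noteq> q u" "\<And>S. S \<in> K \<Longrightarrow> closed_segment (q u) w \<inter> S \<subseteq> {q u}"
  proof (rule exists_free_segment[of K "q u"])
    show "finite K" using V0 finF by (simp add: K_def)
    show "closed S" if "S \<in> K" for S using that closed_hull_finite finF by (auto simp: K_def)
    show "\<exists>b. S = closed_segment (q u) b" if "S \<in> K" "q u \<in> S" for S
    proof -
      from \<open>S \<in> K\<close> consider x where "S = {q x}" "x \<in> V0" | e where "S = convex hull (q ` e)" "e \<in> F"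
        by (auto simp: K_def)
      then show ?thesis
      proof cases
        case 1
        then show ?thesis using that by (intro exI[of _ "q u"]) auto
      next
        case 2
        then have "q u \<in> q ` e" using q V0(3) that by (force simp: straight_drawing_def)
        then have "u \<in> e"
          using q eV0[OF 2(2)] V0(3) by (auto simp: straight_drawing_def dest: inj_onD)
        moreover obtain x y where "e = {x, y}" using forest_card2[OF leaf(1) 2(2)] by (auto simp: card_2_iff)
        ultimately show ?thesis using 2
          by (auto simp: segment_convex_hull) (metis insert_commute)
      qed
    qed
  qed blast
  have sub: "closed_segment (q u) w \<inter> straight_set q V0 F = {q u}"
    using w(2) V0(3) unfolding UK[symmetric] by (auto simp: K_def)
  have wS: "w \<notin> straight_set q V0 F" using sub w(1) by auto
  define q' where "q' = q(v := w)"
  have q'V0: "q' ` e = q ` e" if "e \<subseteq> V0" for e using that V0 by (auto simp: q'_def)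
  have hullF: "convex hull (q' ` e) = convex hull (q ` e)" if "e \<in> F" for e
    using q'V0[OF eV0[OF that]] by simp
  have hulln: "convex hull (q' ` {u, v}) = closed_segment (q u) w"
    using \<open>u \<noteq> v\<close> by (simp add: q'_def segment_convex_hull)
  have q'V: "q' ` V = insert w (q ` V0)" using q'V0[of V0] V0 by (simp add: q'_def)
  have ss: "straight_set q' V (insert {u, v} F) = closed_segment (q u) w \<union> straight_set q V0 F"
    using hullF hulln by (auto simp: straight_set_def q'V)
  have "connected (- straight_set q' V (insert {u, v} F))"
    unfolding ss
  proof (rule Janiszewski_connected)
    show "closed (straight_set q V0 F)" using V0 finF by (intro closed_straight_set) auto
    show "connected (closed_segment (q u) w \<inter> straight_set q V0 F)" by (simp add: sub)
    show "connected (- closed_segment (q u) w)" by (rule connected_complement_bounded_convex) (auto simp: bounded_closed_segment)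
  qed (use q in auto)
  moreover have "straight_drawing q' V (insert {u, v} F)"
    unfolding straight_drawing_def
  proof (intro conjI ballI impI)
    have "inj_on q V0" using q by (simp add: straight_drawing_def)
    then show "inj_on q' V"
      using wS V0 by (auto simp: q'_def inj_on_def straight_set_def)
  next
    fix e assume "e \<in> insert {u, v} F"
    then consider "e = {u, v}" | "e \<in> F" by auto
    then show "convex hull (q' ` e) \<inter> q' ` V \<subseteq> q' ` e"
    proof cases
      case 1
      have "convex hull (q' ` e) \<inter> q' ` V \<subseteq> {q u, w}"
        unfolding 1 hulln q'V using sub by (auto simp: straight_set_def)
      then show ?thesis using \<open>u \<noteq> v\<close> by (auto simp: 1 q'_def)
    next
      case 2
      then have "w \<notin> convex hull (q ` e)" using wS by (auto simp: straight_set_def)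
      then show ?thesis
        using q 2 unfolding hullF[OF 2] q'V q'V0[OF eV0[OF 2]] by (auto simp: straight_drawing_def)
    qed
  next
    fix e e' assume e: "e \<in> insert {u, v} F" "e' \<in> insert {u, v} F" "e \<noteq> e'"
    have *: "closed_segment (q u) w \<inter> convex hull (q' ` e) \<subseteq> q' ` V" if "e \<in> F" for e
      using sub that V0(3) unfolding hullF[OF that] q'V by (auto simp: straight_set_def)
    show "convex hull (q' ` e) \<inter> convex hull (q' ` e') \<subseteq> q' ` V"
    proof (cases "e \<in> F \<and> e' \<in> F")
      case True
      then have "convex hull (q ` e) \<inter> convex hull (q ` e') \<subseteq> q ` V0"
        using q(1) e(3) unfolding straight_drawing_def by blast
      then show ?thesis using True hullF q'V by auto
    next
      case False
      then show ?thesis using e *[of e] *[of e'] hulln by (metis Int_commute insert_iff)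
    qed
  qed
  ultimately show ?case by blast
qed

section \<open>Free discs on the surface\<close>

lemma side_glue_norm: "side_glue g z w \<Longrightarrow> norm z = 1 \<and> norm w = 1"
  by (induction rule: side_glue.induct) (auto simp: polygon_point_def)

text \<open>Each generating identification relates boundary points only, and this survives the
  passage to the generated equivalence. Hence the open polygon is glued to nothing.\<close>

lemma glue_rel_cases:
  assumes "(z, w) \<in> glue_rel g"
  shows "z = w \<or> norm z = 1 \<and> norm w = 1"
proof -
  have "equivclp (side_glue g) z w" using assms by (simp add: glue_rel_def)
  then show ?thesis
    by (induction rule: equivclp_induct) (use side_glue_norm in blast)+
qed

abbreviation disc_proj :: "nat \<Rightarrow> complex \<Rightarrow> complex set" where
  "disc_proj g z \<equiv> glue_rel g `` {z}"

lemma disc_proj_interior: "norm z < 1 \<Longrightarrow> disc_proj g z = {z}"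
  using glue_rel_cases[of z _ g] equiv_class_self[OF equiv_glue_rel, of z g] by fastforce

lemma topspace_genus_surface: "topspace (genus_surface g) = cball 0 1 // glue_rel g"
proof -
  have "topspace (genus_surface g) = disc_proj g ` cball 0 1"
    using quotient_imp_surjective_map[OF quotient_map_genus_surface[of g]] by simp
  then show ?thesis by (auto simp: quotient_def)
qed

lemma continuous_map_disc_proj:
  "S \<subseteq> cball 0 1 \<Longrightarrow> continuous_map (top_of_set S) (genus_surface g) (disc_proj g)"
  using continuous_map_from_subtopology_mono quotient_imp_continuous_map[OF quotient_map_genus_surface]
  by blast

text \<open>Inner points form singleton classes, so the union of the image is \<open>U\<close>
  itself.\<close>

lemma openin_disc_proj:
  assumes "open U" "U \<subseteq> ball 0 1"
  shows "openin (genus_surface g) (disc_proj g ` U)"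
  unfolding openin_genus_surface
proof
  show "disc_proj g ` U \<subseteq> cball 0 1 // glue_rel g"
    using assms(2) by (force simp: quotient_def)
  have "disc_proj g ` U = (\<lambda>z. {z}) ` U"
    using assms(2) by (intro image_cong refl disc_proj_interior) auto
  then have "\<Union> (disc_proj g ` U) = U" by simp
  then show "openin (top_of_set (cball 0 1)) (\<Union> (disc_proj g ` U))"
    using assms by (metis ball_subset_cball open_subset subset_trans)
qed

lemma inj_on_disc_proj: "inj_on (disc_proj g) (ball 0 1)"
  by (rule inj_onI) (simp add: disc_proj_interior)

text \<open>
  The map \<open>z \<mapsto> (\<bar>z\<bar>, (1 - \<bar>z\<bar>) z)\<close> collapses the boundary of the polygon to a point, hence descends
  to the surface, where it separates each inner point of the polygon from all other points. It
  takes the place of the Hausdorff property.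
\<close>

lemma closedin_disc_proj_vimage:
  assumes K: "compactin (genus_surface g) K"
  shows "closedin (top_of_set (ball 0 1)) {z \<in> ball 0 1. disc_proj g z \<in> K}"
proof -
  define \<Phi> :: "complex \<Rightarrow> real \<times> complex" where "\<Phi> z = (norm z, (1 - norm z) *\<^sub>R z)" for z
  define \<Psi> where "\<Psi> A = \<Phi> (SOME z. z \<in> A)" for A
  have cont: "continuous_on S \<Phi>" for S
    unfolding \<Phi>_def by (intro continuous_intros)
  have \<Psi>: "\<Psi> (disc_proj g z) = \<Phi> z" if "z \<in> cball 0 1" for z
  proof -
    have "z \<in> disc_proj g z" using equiv_class_self[OF equiv_glue_rel that] .
    then have "(SOME w. w \<in> disc_proj g z) \<in> disc_proj g z" by (rule someI)
    then have "(z, SOME w. w \<in> disc_proj g z) \<in> glue_rel g" by blast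
    from glue_rel_cases[OF this] show ?thesis by (auto simp: \<Psi>_def \<Phi>_def)
  qed
  have "continuous_map (top_of_set (cball 0 1)) euclidean (\<Psi> \<circ> disc_proj g)"
    using continuous_on_cong[OF refl, of "cball 0 1" "\<Psi> \<circ> disc_proj g" \<Phi>] cont \<Psi> by simp
  then have "continuous_map (genus_surface g) euclidean \<Psi>"
    by (rule continuous_compose_quotient_map[OF quotient_map_genus_surface])
  then have "compact (\<Psi> ` K)"
    using image_compactin[OF K] by (metis compactin_euclidean_iff)
  then have "closedin (top_of_set (ball 0 1)) (ball 0 1 \<inter> \<Phi> -` (\<Psi> ` K))"
    by (intro continuous_closedin_preimage cont compact_imp_closed)
  moreover have "ball 0 1 \<inter> \<Phi> -` (\<Psi> ` K) = {z \<in> ball 0 1. disc_proj g z \<in> K}"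
  proof (intro equalityI subsetI)
    fix z assume z: "z \<in> ball 0 1 \<inter> \<Phi> -` (\<Psi> ` K)"
    then obtain A where A: "A \<in> K" "\<Phi> z = \<Psi> A" by auto
    then obtain w where w: "w \<in> cball 0 1" "A = disc_proj g w"
      using compactin_subset_topspace[OF K] by (auto simp: topspace_genus_surface quotient_def)
    then have "\<Phi> z = \<Phi> w" using A \<Psi> by simp
    then have "z = w" using z by (auto simp: \<Phi>_def)
    then show "z \<in> {z \<in> ball 0 1. disc_proj g z \<in> K}" using z A w by auto
  next
    fix z assume z: "z \<in> {z \<in> ball 0 1. disc_proj g z \<in> K}"
    then have "\<Phi> z = \<Psi> (disc_proj g z)" by (intro \<Psi>[symmetric]) auto
    then show "z \<in> ball 0 1 \<inter> \<Phi> -` (\<Psi> ` K)" using z by simp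
  qed
  ultimately show ?thesis by simp
qed

section \<open>Drawings are nowhere dense in the polygon\<close>

text \<open>Otherwise the inverse of the arc would map a nonempty open set of the plane continuously
  and injectively into the line, against invariance of dimension.\<close>

lemma interior_arc_vimage:
  assumes c: "embedding_map (top_of_set {0..1::real}) (genus_surface g) c"
  shows "interior {z \<in> ball 0 1. disc_proj g z \<in> c ` {0..1}} = {}"
proof (rule ccontr)
  define U where "U = interior {z \<in> ball 0 1. disc_proj g z \<in> c ` {0..1}}"
  assume "interior {z \<in> ball 0 1. disc_proj g z \<in> c ` {0..1}} \<noteq> {}"
  then have ne: "U \<noteq> {}" by (simp add: U_def)
  have U: "U \<subseteq> ball 0 1" "disc_proj g ` U \<subseteq> c ` {0..1}"
    unfolding U_def using interior_subset by blast+
  have "homeomorphic_map (top_of_set {0..1}) (subtopology (genus_surface g) (c ` {0..1})) c"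
    using c by (simp add: embedding_map_def)
  then obtain d where d: "homeomorphic_maps (top_of_set {0..1}) (subtopology (genus_surface g) (c ` {0..1})) c d"
    by (auto simp: homeomorphic_map_maps)
  have "continuous_map (top_of_set U) (subtopology (genus_surface g) (c ` {0..1})) (disc_proj g)"
    using U ball_subset_cball by (intro continuous_map_into_subtopology continuous_map_disc_proj) fastforce+
  then have "continuous_map (top_of_set U) (top_of_set {0..1}) (d \<circ> disc_proj g)"
    by (rule continuous_map_compose) (use d in \<open>simp add: homeomorphic_maps_def\<close>)
  then have "continuous_on U (d \<circ> disc_proj g)"
    by (simp add: continuous_map_in_subtopology)
  moreover have "inj_on (d \<circ> disc_proj g) U"
  proof (rule comp_inj_on)
    show "inj_on (disc_proj g) U" using inj_on_disc_proj U inj_on_subset by blast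
    have "c (d y) = y" if "y \<in> disc_proj g ` U" for y
    proof -
      have "y \<in> topspace (subtopology (genus_surface g) (c ` {0..1}))"
        using that U by (fastforce simp: topspace_genus_surface quotient_def)
      then show ?thesis using d by (simp add: homeomorphic_maps_def)
    qed
    then show "inj_on d (disc_proj g ` U)" by (rule inj_on_inverseI)
  qed
  ultimately have "DIM(complex) \<le> DIM(real)"
    using ne by (intro invariance_of_dimension[of U "d \<circ> disc_proj g"]) (auto simp: U_def)
  then show False by simp
qed

lemma interior_finite_Union_closed:
  assumes "finite \<T>" "\<And>T. T \<in> \<T> \<Longrightarrow> closed T \<and> interior T = {}"
  shows "interior (\<Union>\<T>) = {}"
  using assms
proof (induction rule: finite_induct)
  case (insert T \<T>)
  then show ?case using interior_closed_Un_empty_interior[of T "\<Union>\<T>"] by simp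
qed auto

text \<open>A drawing is a finite union of points and arcs, whose preimages are closed with empty
  interior. They cannot cover a disc, and what they leave uncovered is open.\<close>

lemma exists_free_disc:
  assumes emb: "embedding_on (genus_surface g) n E p c" and "finite E"
  obtains a r where "0 < r" "ball a r \<subseteq> ball 0 1" "disc_proj g ` ball a r \<inter> drawing n E p c = {}"
proof -
  \<comment> \<open>The preimages are closed relative to the open unit disc; cutting them down to a
    smaller closed disc makes them closed in the plane.\<close>
  define P where "P K = {z \<in> cball 0 (1/2). disc_proj g z \<in> K}" for K
  define \<K> where "\<K> = (\<lambda>i. {p i}) ` {1..n} \<union> (\<lambda>e. c e ` {0..1}) ` E"
  have D: "drawing n E p c = \<Union>\<K>" by (auto simp: \<K>_def drawing_def)
  have "closed (P K) \<and> interior (P K) = {}" if "K \<in> \<K>" for K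
  proof
    have comp: "compactin (genus_surface g) K"
    proof -
      from that consider i where "i \<in> {1..n}" "K = {p i}" | e where "e \<in> E" "K = c e ` {0..1}"
        by (auto simp: \<K>_def)
      then show ?thesis
      proof cases
        case 1
        then show ?thesis using emb by (auto simp: embedding_on_def)
      next
        case 2
        then have "embedding_map (top_of_set {0..1}) (genus_surface g) (c e)"
          using emb by (auto simp: embedding_on_def)
        then have "continuous_map (top_of_set {0..1}) (genus_surface g) (c e)"
          using continuous_map_in_subtopology embedding_map_def homeomorphic_imp_continuous_map by blast
        moreover have "compactin (top_of_set {0..1::real}) {0..1}"
          by (simp add: compactin_subtopology)
        ultimately show ?thesis using 2 image_compactin by blast
      qed
    qed
    then obtain T where T: "closed T" "{z \<in> ball 0 1. disc_proj g z \<in> K} = ball 0 1 \<inter> T"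
      using closedin_disc_proj_vimage by (metis (no_types, lifting) closedin_closed)
    have "P K = cball 0 (1/2) \<inter> {z \<in> ball 0 1. disc_proj g z \<in> K}" by (auto simp: P_def)
    also have "\<dots> = cball 0 (1/2) \<inter> T" unfolding T(2) by auto
    finally show "closed (P K)" using T(1) by auto
    have sub: "P K \<subseteq> {z \<in> ball 0 1. disc_proj g z \<in> K}" by (auto simp: P_def)
    from that consider i where "i \<in> {1..n}" "K = {p i}" | e where "e \<in> E" "K = c e ` {0..1}"
      by (auto simp: \<K>_def)
    then show "interior (P K) = {}"
    proof cases
      case 1
      have "z = w" if "z \<in> P K" "w \<in> P K" for z w
        using sub that inj_on_disc_proj[of g] 1 by (auto simp: inj_on_def subset_iff)
      then have "P K = {} \<or> (\<exists>z. P K = {z})" by blast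
      then show ?thesis by auto
    next
      case 2
      then show ?thesis
        using interior_arc_vimage[of g "c e"] interior_mono[OF sub] emb by (auto simp: embedding_on_def)
    qed
  qed
  moreover have "finite \<K>" using \<open>finite E\<close> by (simp add: \<K>_def)
  ultimately have clo: "closed (\<Union>(P ` \<K>))" and int: "interior (\<Union>(P ` \<K>)) = {}"
    by (intro closed_Union ballI interior_finite_Union_closed; auto)+
  have "\<not> ball 0 (1/2) \<subseteq> \<Union>(P ` \<K>)"
    using int interior_maximal[of "ball 0 (1/2)" "\<Union>(P ` \<K>)"] by auto
  then obtain a where a: "a \<in> ball 0 (1/2) - \<Union>(P ` \<K>)" by blast
  then obtain r where r: "r > 0" "ball a r \<subseteq> ball 0 (1/2) - \<Union>(P ` \<K>)"
    using clo by (metis open_Diff open_ball open_contains_ball)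
  show ?thesis
  proof
    show "ball a r \<subseteq> ball 0 1" using r(2) by auto
    show "disc_proj g ` ball a r \<inter> drawing n E p c = {}"
      unfolding D using r(2) by (fastforce simp: P_def)
  qed fact
qed

text \<open>An open disc is homeomorphic to the plane, so a planar drawing of any extent can be
  placed in the free disc without rescaling.\<close>

lemma exists_free_plane:
  assumes emb: "embedding_on (genus_surface g) n E p c" and "finite E"
  obtains h :: "complex \<Rightarrow> complex set"
  where "continuous_map euclidean (genus_surface g) h" "open_map euclidean (genus_surface g) h"
    "inj h" "range h \<inter> drawing n E p c = {}"
proof -
  obtain a r where r: "0 < r" "ball a r \<subseteq> ball 0 1" "disc_proj g ` ball a r \<inter> drawing n E p c = {}"
    using exists_free_disc[OF assms] .
  obtain k l where k: "homeomorphism (UNIV :: complex set) (ball a r) k l"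
    using homeomorphic_ball_UNIV[OF r(1), of a] homeomorphic_sym homeomorphic_def by metis
  show ?thesis
  proof
    have "continuous_map euclidean (top_of_set (ball a r)) k"
      using k by (auto simp: homeomorphism_def continuous_map_in_subtopology)
    then show "continuous_map euclidean (genus_surface g) (disc_proj g \<circ> k)"
      by (rule continuous_map_compose) (use r in \<open>force intro!: continuous_map_disc_proj\<close>)
    show "open_map euclidean (genus_surface g) (disc_proj g \<circ> k)"
      unfolding open_map_def
    proof (intro allI impI)
      fix U :: "complex set" assume "openin euclidean U"
      then have "openin (top_of_set (ball a r)) (k ` U)"
        using homeomorphism_imp_open_map[OF k, of U] by simp
      then have "open (k ` U)" "k ` U \<subseteq> ball 0 1"
        using openin_open_trans[of "ball a r" "k ` U"] openin_imp_subset r(2) by (blast+)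
      then show "openin (genus_surface g) ((disc_proj g \<circ> k) ` U)"
        by (metis image_comp openin_disc_proj)
    qed
    have rk: "range k = ball a r" using k by (simp add: homeomorphism_def)
    have "inj k" using k by (metis UNIV_I homeomorphism_apply1 injI)
    moreover have "inj_on (disc_proj g) (range k)"
      using inj_on_disc_proj r(2) inj_on_subset unfolding rk by blast
    ultimately show "inj (disc_proj g \<circ> k)" by (rule comp_inj_on)
    show "range (disc_proj g \<circ> k) \<inter> drawing n E p c = {}"
      using r(3) rk by (metis image_comp)
  qed
qed

section \<open>Adding a forest to an embedding\<close>

lemma linepath_in_ends_iff:
  fixes a b :: complex
  assumes "a \<noteq> b"
  shows "linepath a b t \<in> {a, b} \<longleftrightarrow> t = 0 \<or> t = 1"
proof -
  have "linepath a b t = a + of_real t * (b - a)" "linepath a b t = b + of_real (t - 1) * (b - a)"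
    by (simp_all add: linepath_def scaleR_conv_of_real algebra_simps)
  then have "linepath a b t = a \<longleftrightarrow> t = 0" "linepath a b t = b \<longleftrightarrow> t = 1"
    using assms by (metis add_cancel_right_right eq_iff_diff_eq_0 mult_eq_0_iff of_real_eq_0_iff)+
  then show ?thesis by simp
qed

lemma embedding_map_linepath:
  fixes a b :: complex
  assumes "a \<noteq> b"
  shows "embedding_map (top_of_set {0..1}) euclidean (linepath a b)"
  by (rule continuous_imp_embedding_map)
    (use assms in \<open>auto intro: inj_on_linepath simp: compact_space_subtopology\<close>)

text \<open>Near its midpoint an edge is the only part of the drawing. The chart is an affine map of
  the unit disc that sends the real diameter into the edge, followed by \<open>h\<close>; both open
  half discs then miss the drawing.\<close>

lemma straight_drawing_side_chart:
  assumes h: "continuous_map euclidean X h" "open_map euclidean X h" "inj h"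
    and sd: "straight_drawing q V F" "finite V" "finite F" "\<And>e. e \<in> F \<Longrightarrow> finite e"
    and e: "e \<in> F" "q ` e = {a, b}" "a \<noteq> b"
    and D: "h ` straight_set q V F = range h \<inter> D"
  shows "\<exists>k. side_chart X D (h \<circ> linepath a b) k \<and>
             k ` {z \<in> ball 0 1. Im z \<noteq> 0} \<subseteq> h ` (- straight_set q V F)"
proof -
  define S' where "S' = q ` V \<union> (\<Union>e'\<in>F - {e}. convex hull (q ` e'))"
  define \<mu> where "\<mu> = linepath a b (1/2)"
  have hull: "convex hull (q ` e) = closed_segment a b" using e by (simp add: segment_convex_hull)
  have S: "straight_set q V F = closed_segment a b \<union> S'"
    using e(1) hull by (auto simp: straight_set_def S'_def)
  have "closed S'"
    unfolding S'_def using sd by (intro closed_Un closed_UN ballI finite_imp_closed closed_hull_finite) auto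
  \<comment> \<open>Two edges meet only in vertices, and the only vertices on an edge are its ends,
    which the midpoint is not.\<close>
  moreover have "\<mu> \<notin> S'"
  proof
    assume "\<mu> \<in> S'"
    moreover have seg: "\<mu> \<in> closed_segment a b" by (auto simp: \<mu>_def linepath_in_path)
    ultimately have "\<mu> \<in> q ` V"
      using sd(1) e(1) hull unfolding straight_drawing_def S'_def by blast
    then have "\<mu> \<in> q ` e"
      using sd(1) e(1) hull seg unfolding straight_drawing_def by blast
    then show False using linepath_in_ends_iff[OF e(3), of "1/2"] e(2) by (auto simp: \<mu>_def)
  qed
  ultimately obtain r where r: "r > 0" "ball \<mu> r \<inter> S' = {}"
    by (metis Compl_iff disjoint_eq_subset_Compl open_Compl open_contains_ball)
  \<comment> \<open>The bound \<open>1/2\<close> keeps the diameter inside the edge; the other bound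
    keeps the disc within distance \<open>r\<close> of the midpoint, away from
    \<open>S'\<close>.\<close>
  define s where "s = min (1/2) (r / norm (b - a))"
  have s: "0 < s" "s \<le> 1/2" "s * norm (b - a) \<le> r"
    using r e(3) by (auto simp: s_def min_def field_simps)
  define A where "A z = \<mu> + of_real s * (b - a) * z" for z
  have \<mu>': "\<mu> = a + of_real (1/2) * (b - a)"
    by (simp add: \<mu>_def linepath_def scaleR_conv_of_real field_simps)
  have linA: "linepath a b t = A (of_real ((t - 1/2) / s))" for t
    using s by (simp add: A_def \<mu>' linepath_def scaleR_conv_of_real field_simps)
  have injA: "inj A" using s e(3) by (auto simp: A_def inj_def)
  have Aball: "A z \<in> ball \<mu> r" if "z \<in> ball 0 1" for z
  proof -
    have "s * norm (b - a) * norm z < s * norm (b - a) * 1"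
      using that s e(3) by (intro mult_strict_left_mono) auto
    moreover have "dist \<mu> (A z) = s * norm (b - a) * norm z"
      using s by (simp add: A_def dist_norm norm_mult)
    ultimately show ?thesis unfolding mem_ball using s(3) by linarith
  qed
  have seg_iff: "A z \<in> straight_set q V F \<longleftrightarrow> Im z = 0" if z: "z \<in> ball 0 1" for z
  proof
    assume "A z \<in> straight_set q V F"
    then have "A z \<in> closed_segment a b" using Aball[OF z] r(2) S by auto
    then obtain t where "A z = linepath a b t" by (auto simp: linepath_image_01[symmetric])
    then have "z = of_real ((t - 1/2) / s)" using linA injA by (metis injD)
    then show "Im z = 0" by simp
  next
    assume "Im z = 0"
    then have zr: "z = of_real (Re z)" by (simp add: complex_eq_iff)
    have "\<bar>Re z\<bar> < 1" using z abs_Re_le_cmod[of z] by auto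
    then have "s * \<bar>Re z\<bar> \<le> 1/2 * 1" using s by (intro mult_mono) auto
    then have "\<bar>s * Re z\<bar> \<le> 1/2" using s by (simp add: abs_mult)
    then have "1/2 + s * Re z \<in> {0..1}" by (auto simp: abs_le_iff)
    moreover have "A z = linepath a b (1/2 + s * Re z)"
      unfolding linA using zr s by simp
    ultimately show "A z \<in> straight_set q V F" unfolding S by (metis UnI1 image_eqI linepath_image_01)
  qed
  have arc: "A z \<in> linepath a b ` {0<..<1}" if z: "z \<in> ball 0 1" "Im z = 0" for z
  proof -
    have zr: "z = of_real (Re z)" using z by (simp add: complex_eq_iff)
    have "\<bar>Re z\<bar> < 1" using z abs_Re_le_cmod[of z] by auto
    then have "s * \<bar>Re z\<bar> < s * 1" using s by (intro mult_strict_left_mono) auto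
    moreover have "\<bar>s * Re z\<bar> = s * \<bar>Re z\<bar>" using s by (simp add: abs_mult)
    ultimately have "\<bar>s * Re z\<bar> < 1/2" using s(2) by linarith
    then have "1/2 + s * Re z \<in> {0<..<1}" by (auto simp: abs_less_iff)
    moreover have "A z = linepath a b (1/2 + s * Re z)"
      unfolding linA using zr s by simp
    ultimately show ?thesis by blast
  qed
  have openA: "open (A ` U)" if "open U" for U
  proof -
    have "A ` U = (\<lambda>w. (w - \<mu>) / (of_real s * (b - a))) -` U"
      using s e(3) by (force simp: A_def image_iff field_simps)
    moreover have "open ((\<lambda>w. (w - \<mu>) / (of_real s * (b - a))) -` U)"
      using that s e(3) by (intro open_vimage continuous_intros) auto
    ultimately show ?thesis by simp
  qed
  have openhA: "openin X ((h \<circ> A) ` U)" if "open U" for U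
    using h(2) openA[OF that] unfolding open_map_def by (metis image_comp open_openin)
  have "side_chart X D (h \<circ> linepath a b) (h \<circ> A)"
    unfolding side_chart_def
  proof (intro conjI)
    have "continuous_map euclidean X (h \<circ> A)"
      by (rule continuous_map_compose[OF _ h(1)]) (unfold A_def continuous_map_iff_continuous2, intro continuous_intros)
    moreover have "open_map (top_of_set (ball 0 1)) X (h \<circ> A)"
      unfolding open_map_def using openhA openin_open_trans by (metis open_ball)
    moreover have "inj_on (h \<circ> A) (ball 0 1)"
      using inj_compose[OF h(3) injA] inj_on_subset by blast
    ultimately show "embedding_map (top_of_set (ball 0 1)) X (h \<circ> A)"
      by (intro injective_open_imp_embedding_map continuous_map_from_subtopology) auto
    show "openin X ((h \<circ> A) ` ball 0 1)" by (rule openhA) simp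
    have "h y \<in> D \<longleftrightarrow> y \<in> straight_set q V F" for y
      using D h(3) by (metis IntD2 IntI image_eqI inj_image_mem_iff rangeI)
    then show "(h \<circ> A) ` {z \<in> ball 0 1. Im z = 0} = (h \<circ> A) ` ball 0 1 \<inter> D"
      using seg_iff by auto
    show "(h \<circ> A) ` {z \<in> ball 0 1. Im z = 0} \<subseteq> (h \<circ> linepath a b) ` {0<..<1}"
      using arc by fastforce
  qed
  moreover have "(h \<circ> A) ` {z \<in> ball 0 1. Im z \<noteq> 0} \<subseteq> h ` (- straight_set q V F)"
    using seg_iff by auto
  ultimately show ?thesis by blast
qed

text \<open>\<open>R\<close> keeps its arcs, while the vertices and edges of \<open>F\<close> are
  redrawn inside the free patch \<open>range h\<close>. The complement of the straight drawing is
  connected, so its image lies in one face \<open>f\<close>, and every edge of \<open>F\<close> has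
  both sides in \<open>f\<close>.\<close>

lemma add_forest:
  assumes emb: "embedding_on X n R p c" and "finite R" and eR: "\<And>e. e \<in> R \<Longrightarrow> e \<subseteq> {1..n}"
    and h: "continuous_map euclidean X h" "open_map euclidean X h" "inj (h :: complex \<Rightarrow> _)"
    and hD: "range h \<inter> drawing n R p c = {}"
    and F: "forest F" "\<Union>F \<subseteq> {1..n}" "\<Union>R \<inter> \<Union>F = {}"
  shows "\<exists>p' c' f. embedding_on X n (R \<union> F) p' c' \<and> f \<in> embedding_faces X n (R \<union> F) p' c' \<and>
    2 * card F \<le> face_size X n (R \<union> F) p' c' f"
proof -
  define V where "V = \<Union>F"
  have finV: "finite V" and finF: "finite F"
    using F forest_finite_Union forest_finite by (auto simp: V_def)
  obtain q where q: "straight_drawing q V F" "connected (- straight_set q V F)"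
    using forest_drawing[OF F(1) finV] by (auto simp: V_def)
  have injq: "inj_on q V" using q by (simp add: straight_drawing_def)
  define S where "S = straight_set q V F"
  \<comment> \<open>\<open>Min\<close> and \<open>Max\<close> merely orient each two-element
    edge.\<close>
  define l where "l e = linepath (q (Min e)) (q (Max e))" for e
  define p' where "p' i = (if i \<in> V then h (q i) else p i)" for i
  define c' where "c' e = (if e \<in> F then h \<circ> l e else c e)" for e
  have edge: "q (Min e) \<noteq> q (Max e)" "q ` e = {q (Min e), q (Max e)}" "finite e"
    if eF: "e \<in> F" for e
  proof -
    obtain x y where xy: "e = {x, y}" "x \<noteq> y" using forest_card2[OF F(1) eF] by (auto simp: card_2_iff)
    then have mm: "{Min e, Max e} = e" "Min e \<noteq> Max e" by (auto simp: min_def max_def)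
    have "e \<subseteq> V" using eF by (auto simp: V_def)
    then show "q (Min e) \<noteq> q (Max e)" using mm injq by (metis inj_on_eq_iff insert_subset)
    show "q ` e = {q (Min e), q (Max e)}" using mm(1) by (metis image_empty image_insert)
    show "finite e" using xy by simp
  qed
  have RF: "R \<inter> F = {}"
  proof (rule ccontr)
    assume "R \<inter> F \<noteq> {}"
    then obtain e where e: "e \<in> R" "e \<in> F" by blast
    then have "e = {}" using F(3) by blast
    then show False using forest_card2[OF F(1) e(2)] by simp
  qed
  have V: "V \<subseteq> {1..n}" using F by (simp add: V_def)
  have hull: "l e ` {0..1} = convex hull (q ` e)" if "e \<in> F" for e
    using edge[OF that] by (simp add: l_def linepath_image_01 segment_convex_hull)
  have lopen: "l e t \<in> convex hull (q ` e) - q ` e" if "e \<in> F" "t \<in> {0<..<1}" for e t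
  proof
    show "l e t \<in> convex hull (q ` e)" using hull[OF that(1)] that(2) by force
    show "l e t \<notin> q ` e"
      using linepath_in_ends_iff[OF edge(1)[OF that(1)], of t] that edge(2)[OF that(1)] by (auto simp: l_def)
  qed
  have lV: "l e t \<notin> q ` V" if "e \<in> F" "t \<in> {0<..<1}" for e t
  proof -
    have "convex hull (q ` e) \<inter> q ` V \<subseteq> q ` e"
      using q(1) that(1) by (simp add: straight_drawing_def)
    then show ?thesis using lopen[OF that] by blast
  qed
  have img: "(\<Union>e\<in>R \<union> F. c' e ` {0..1}) = (\<Union>e\<in>R. c e ` {0..1}) \<union> h ` (\<Union>e\<in>F. convex hull (q ` e))"
  proof -
    have "c' e ` {0..1} = h ` (convex hull (q ` e))" if "e \<in> F" for e
      using hull[OF that] that by (metis c'_def image_comp)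
    moreover have "c' e = c e" if "e \<in> R" for e using RF that by (auto simp: c'_def)
    ultimately show ?thesis by (simp add: image_UN)
  qed
  have p'img: "p' ` {1..n} = p ` ({1..n} - V) \<union> h ` q ` V"
    using V by (auto simp: p'_def)
  have oldD: "p ` {1..n} \<subseteq> drawing n R p c" "\<And>e. e \<in> R \<Longrightarrow> c e ` {0..1} \<subseteq> drawing n R p c"
    by (auto simp: drawing_def)
  have sub: "c e ` {0<..<1} \<subseteq> drawing n R p c" if "e \<in> R" for e
    by (rule order_trans[OF image_mono oldD(2)[OF that]]) auto
  have hold: "h z \<notin> drawing n R p c" for z using hD by blast
  have subh: "c e ` {0<..<1} \<inter> h ` A = {}" if "e \<in> R" for e A
  proof (rule equals0I)
    fix y assume y: "y \<in> c e ` {0<..<1} \<inter> h ` A"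
    then obtain z where "y = h z" by auto
    then show False using sub[OF that] y hold[of z] by (metis IntD1 subsetD)
  qed
  \<comment> \<open>The patch contains nothing of the old drawing, so there the new drawing is
    exactly the image of the straight one.\<close>
  have D': "range h \<inter> drawing n (R \<union> F) p' c' = h ` S"
  proof -
    have "drawing n (R \<union> F) p' c' \<subseteq> drawing n R p c \<union> h ` S"
      unfolding drawing_def[of n "R \<union> F"] img p'img by (auto simp: drawing_def S_def straight_set_def)
    moreover have "h ` S \<subseteq> drawing n (R \<union> F) p' c'"
      unfolding drawing_def[of n "R \<union> F"] img p'img by (auto simp: S_def straight_set_def)
    ultimately show ?thesis using hold by blast
  qed
  have emb': "embedding_on X n (R \<union> F) p' c'"
    unfolding embedding_on_def
  proof (intro conjI ballI impI)
    have injp: "inj_on p {1..n}" using emb by (simp add: embedding_on_def)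
    show "inj_on p' {1..n}"
    proof (rule inj_onI)
      fix i j assume ij: "i \<in> {1..n}" "j \<in> {1..n}" "p' i = p' j"
      show "i = j"
        using ij inj_onD[OF injp] inj_onD[OF injq] injD[OF h(3)] oldD(1) hold
        by (auto simp: p'_def split: if_splits) (metis image_subset_iff atLeastAtMost_iff)+
    qed
    have "range h \<subseteq> topspace X" using h(1) by (auto simp: continuous_map_def)
    then show "p' ` {1..n} \<subseteq> topspace X"
      using emb unfolding p'img by (auto simp: embedding_on_def)
  next
    fix e assume e: "e \<in> R \<union> F"
    show "embedding_map (top_of_set {0..1}) X (c' e)"
    proof (cases "e \<in> F")
      case True
      have "embedding_map euclidean X h"
        using h by (intro injective_open_imp_embedding_map) auto
      then show ?thesis
        using True embedding_map_compose[OF embedding_map_linepath[OF edge(1)[OF True]]]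
        by (simp add: c'_def l_def)
    next
      case False
      then show ?thesis using e emb by (auto simp: c'_def embedding_on_def)
    qed
    show "{c' e 0, c' e 1} = p' ` e"
    proof (cases "e \<in> F")
      case True
      then have "e \<subseteq> V" by (auto simp: V_def)
      then have "p' ` e = h ` q ` e" by (force simp: p'_def)
      then show ?thesis using True edge(2)[OF True] by (simp add: c'_def l_def linepath_def)
    next
      case False
      then have "e \<in> R" using e by simp
      then have "p' ` e = p ` e" using F(3) by (intro image_cong) (auto simp: p'_def V_def)
      then show ?thesis using False \<open>e \<in> R\<close> emb by (simp add: c'_def embedding_on_def)
    qed
    show "c' e ` {0<..<1} \<inter> p' ` {1..n} = {}"
    proof (cases "e \<in> F")
      case True
      have "x \<notin> p' ` {1..n}" if "x \<in> c' e ` {0<..<1}" for x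
      proof -
        from that True obtain t where t: "t \<in> {0<..<1}" "x = h (l e t)" by (auto simp: c'_def)
        then have "x \<notin> h ` q ` V" using lV[OF True t(1)] inj_image_mem_iff[OF h(3)] by simp
        moreover have "x \<notin> p ` ({1..n} - V)" using t(2) oldD(1) hold[of "l e t"] by auto
        ultimately show ?thesis unfolding p'img by simp
      qed
      then show ?thesis by blast
    next
      case False
      then have "e \<in> R" using e by simp
      then have "c e ` {0<..<1} \<inter> p ` {1..n} = {}" using emb by (simp add: embedding_on_def)
      moreover have "c e ` {0<..<1} \<inter> h ` q ` V = {}" by (rule subh[OF \<open>e \<in> R\<close>])
      ultimately have "c e ` {0<..<1} \<inter> p' ` {1..n} = {}" unfolding p'img by blast
      then show ?thesis using False by (simp add: c'_def)
    qed
  next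
    fix e e' assume e: "e \<in> R \<union> F" "e' \<in> R \<union> F" "e \<noteq> e'"
    have FF: "h (l e t) \<noteq> h (l e' t')" if "e \<in> F" "e' \<in> F" "t \<in> {0<..<1}" "t' \<in> {0<..<1}" for t t'
    proof
      assume "h (l e t) = h (l e' t')"
      then have "l e t = l e' t'" using h(3) by (simp add: inj_eq)
      moreover have "convex hull (q ` e) \<inter> convex hull (q ` e') \<subseteq> q ` V"
        using q(1) that(1,2) e(3) by (simp add: straight_drawing_def)
      ultimately have "l e t \<in> q ` V"
        using lopen[OF that(1,3)] lopen[OF that(2,4)] by auto
      then show False using lV[OF that(1,3)] by contradiction
    qed
    show "c' e ` {0<..<1} \<inter> c' e' ` {0<..<1} = {}"
    proof (cases "e \<in> F"; cases "e' \<in> F")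
      assume "e \<in> F" "e' \<in> F"
      then show ?thesis using FF by (auto simp: c'_def)
    next
      assume "e \<in> F" "e' \<notin> F"
      then have "c' e ` {0<..<1} = h ` l e ` {0<..<1}" "c' e' = c e'" "e' \<in> R"
        using e(2) by (simp_all add: c'_def image_comp)
      then show ?thesis using subh[of e'] by (metis Int_commute)
    next
      assume "e \<notin> F" "e' \<in> F"
      then have "c' e' ` {0<..<1} = h ` l e' ` {0<..<1}" "c' e = c e" "e \<in> R"
        using e(1) by (simp_all add: c'_def image_comp)
      then show ?thesis using subh[of e] by (simp only:)
    next
      assume "e \<notin> F" "e' \<notin> F"
      then have "c' e = c e" "c' e' = c e'" "e \<in> R" "e' \<in> R"
        using e(1,2) by (simp_all add: c'_def)
      then show ?thesis using e(3) emb by (simp add: embedding_on_def)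
    qed
  qed
  let ?D = "drawing n (R \<union> F) p' c'"
  have hS: "h ` (- S) \<subseteq> topspace X - ?D"
  proof -
    have "range h \<subseteq> topspace X" using h(1) by (auto simp: continuous_map_def)
    moreover have "h z \<notin> ?D" if "z \<notin> S" for z
      using that D' h(3) by (metis IntI inj_image_mem_iff rangeI)
    ultimately show ?thesis by auto
  qed
  have con: "connectedin (subtopology X (topspace X - ?D)) (h ` (- S))"
    unfolding connectedin_subtopology
  proof
    have "connectedin euclidean (- S)" using q(2) by (simp add: S_def)
    then show "connectedin X (h ` (- S))" using connectedin_continuous_map_image[OF h(1)] by blast
  qed (rule hS)
  \<comment> \<open>Boundedness yields a point off the drawing, so the complement is nonempty and
    has a component containing the connected image.\<close>
  have "bounded S"
    unfolding S_def straight_set_def using finV finF edge(3)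
    by (intro bounded_Un[THEN iffD2] conjI bounded_UN ballI)
      (simp_all add: bounded_convex_hull finite_imp_bounded)
  then obtain z where "z \<notin> S" using not_bounded_UNIV by (metis UNIV_eq_I)
  then have "h z \<in> topspace (subtopology X (topspace X - ?D))"
    using hS by (simp add: image_subset_iff)
  then have "subtopology X (topspace X - ?D) \<noteq> trivial_topology"
    by (metis empty_iff null_topspace_iff_trivial)
  then obtain f where f: "f \<in> embedding_faces X n (R \<union> F) p' c'" "h ` (- S) \<subseteq> f"
    using exists_connected_component_of_superset[OF con] unfolding embedding_faces_def by blast
  have two: "sides_in X ?D (c' e) f = 2" if e: "e \<in> F" for e
  proof -
    have "h ` straight_set q V F = range h \<inter> ?D" using D' by (simp add: S_def)
    from straight_drawing_side_chart[OF h q(1) finV finF edge(3) e edge(2)[OF e] edge(1)[OF e] this]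
    obtain k where k: "side_chart X ?D (h \<circ> l e) k" "k ` {z \<in> ball 0 1. Im z \<noteq> 0} \<subseteq> h ` (- S)"
      unfolding l_def S_def by blast
    then have "\<exists>k. side_chart X ?D (c' e) k \<and> k ` {z \<in> ball 0 1. Im z \<noteq> 0} \<subseteq> f"
      using order_trans[OF k(2) f(2)] e by (auto simp only: c'_def if_True)
    then show ?thesis by (simp only: sides_in_def if_True)
  qed
  have "2 * card F = (\<Sum>e\<in>F. sides_in X ?D (c' e) f)" by (simp add: two)
  also have "\<dots> \<le> face_size X n (R \<union> F) p' c' f"
    unfolding face_size_def using \<open>finite R\<close> finF by (intro sum_mono2) auto
  finally show ?thesis using emb' f(1) by (intro exI conjI)
qed

section \<open>Consequences for the genus bound and the largest face\<close>

lemma genus_at_most_mono: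
  assumes "genus_at_most g n E" "E' \<subseteq> E"
  shows "genus_at_most g n E'"
proof -
  obtain p c where "embedding_on (genus_surface g) n E p c"
    using assms by (auto simp: genus_at_most_def)
  then have "embedding_on (genus_surface g) n E' p c"
    using assms(2) by (auto simp: embedding_on_def subset_iff)
  then show ?thesis by (auto simp: genus_at_most_def)
qed

lemma genus_at_most_empty: "genus_at_most g n {}"
proof -
  \<comment> \<open>For positive \<open>i\<close> these are the distinct points 1/2, 1/3, ... of the
    open disc, where the projection to the surface is injective.\<close>
  define z where "z i = (1 / (1 + of_nat i) :: complex)" for i :: nat
  have inj: "inj z" by (auto simp: z_def inj_def)
  have "z i \<in> ball 0 1" if "i \<in> {1..n}" for i
  proof -
    have "norm (1 + of_nat i :: complex) = 1 + real i"
      by (metis norm_of_nat of_nat_Suc)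
    then show ?thesis using that by (simp add: z_def norm_divide)
  qed
  then have z: "z ` {1..n} \<subseteq> ball 0 1" by blast
  have "inj_on (disc_proj g \<circ> z) {1..n}"
    using inj z by (metis comp_inj_on inj_on_disc_proj inj_on_subset subset_UNIV)
  moreover have "(disc_proj g \<circ> z) ` {1..n} \<subseteq> topspace (genus_surface g)"
    using z ball_subset_cball unfolding topspace_genus_surface by (fastforce intro: quotientI)
  ultimately have "embedding_on (genus_surface g) n {} (disc_proj g \<circ> z) undefined"
    by (simp add: embedding_on_def)
  then show ?thesis by (auto simp: genus_at_most_def)
qed

text \<open>The surface of genus exactly \<open>g\<close> is among those over which
  \<open>largest_face\<close> maximises, so the single face from \<open>add_forest\<close> bounds it
  from below.\<close>

lemma genus_at_most_add_forest:
  assumes "genus_at_most g n R" "finite R" "\<And>e. e \<in> R \<Longrightarrow> e \<subseteq> {1..n}"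
    and "forest F" "\<Union>F \<subseteq> {1..n}" "\<Union>R \<inter> \<Union>F = {}"
  shows "genus_at_most g n (R \<union> F)" and "2 * card F \<le> largest_face g n (R \<union> F)"
proof -
  obtain p c where pc: "embedding_on (genus_surface g) n R p c"
    using assms(1) by (auto simp: genus_at_most_def)
  obtain h :: "complex \<Rightarrow> complex set" where h: "continuous_map euclidean (genus_surface g) h"
      "open_map euclidean (genus_surface g) h" "inj h" "range h \<inter> drawing n R p c = {}"
    using exists_free_plane[OF pc assms(2)] .
  obtain p' c' f where "embedding_on (genus_surface g) n (R \<union> F) p' c'"
      "f \<in> embedding_faces (genus_surface g) n (R \<union> F) p' c'"
      and le: "2 * card F \<le> face_size (genus_surface g) n (R \<union> F) p' c' f"
    using add_forest[OF pc assms(2,3) h assms(4-6)] by blast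
  then have "face_size (genus_surface g) n (R \<union> F) p' c' f \<in> face_sizes g n (R \<union> F)"
    and "genus_at_most g n (R \<union> F)"
    unfolding face_sizes_def genus_at_most_def by blast+
  then show "genus_at_most g n (R \<union> F)" "2 * card F \<le> largest_face g n (R \<union> F)"
    using le Max_ge[OF finite_face_sizes] unfolding largest_face_def by (auto intro: order_trans)
qed

lemma largest_face_le:
  assumes "genus_at_most g n E" "finite E" "\<And>e. e \<in> E \<Longrightarrow> e \<subseteq> {1..n}"
  shows "largest_face g n E \<le> 2 * card E"
proof -
  obtain p c where pc: "embedding_on (genus_surface g) n E p c"
    using assms(1) by (auto simp: genus_at_most_def)
  obtain h :: "complex \<Rightarrow> complex set" where h: "continuous_map euclidean (genus_surface g) h"
      "open_map euclidean (genus_surface g) h" "inj h" "range h \<inter> drawing n E p c = {}"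
    using exists_free_plane[OF pc assms(2)] .
  \<comment> \<open>Adding the empty forest provides some face, so that \<open>Max\<close> is taken
    over a nonempty set.\<close>
  obtain p' c' f where "embedding_on (genus_surface g) n (E \<union> {}) p' c'"
      "f \<in> embedding_faces (genus_surface g) n (E \<union> {}) p' c'"
    using add_forest[OF pc assms(2,3) h forest.empty] by auto
  then have "face_sizes g n E \<noteq> {}" unfolding face_sizes_def by auto blast
  then have "Max (face_sizes g n E) \<in> face_sizes g n E" by (rule Max_in[OF finite_face_sizes])
  then show ?thesis by (auto simp: largest_face_def face_sizes_def face_size_le)
qed

section \<open>Isolated vertices and isolated edges\<close>

text \<open>
  Peeling off a vertex of degree 1 reduces to graphs of minimum degree 2, where \<open>card (\<Union>E) \<le> card E\<close>.
\<close>

lemma forest_split: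
  assumes "finite E" "\<And>e. e \<in> E \<Longrightarrow> card e = 2"
  shows "\<exists>R F. E = R \<union> F \<and> forest F \<and> \<Union>R \<inter> \<Union>F = {} \<and> card (\<Union>E) \<le> card F + card E"
  using assms
proof (induction "card E" arbitrary: E rule: less_induct)
  case less
  have fin: "finite (\<Union>E)"
    using less.prems by (metis card.infinite finite_Union zero_neq_numeral)
  show ?case
  proof (cases "\<exists>v\<in>\<Union>E. card {e \<in> E. v \<in> e} \<le> 1")
    case True
    then obtain v where v: "v \<in> \<Union>E" "card {e \<in> E. v \<in> e} \<le> 1" by blast
    then obtain e where e: "e \<in> E" "v \<in> e" by blast
    then have uniq: "e' = e" if "e' \<in> E" "v \<in> e'" for e'
      using v(2) that less.prems(1) card_le_Suc0_iff_eq[of "{e \<in> E. v \<in> e}"] by auto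
    obtain u where u: "e = {u, v}" "u \<noteq> v"
      using less.prems(2)[OF e(1)] e(2) by (auto simp: card_2_iff)
    define E0 where "E0 = E - {e}"
    have E: "E = insert e E0" "e \<notin> E0" "card E = Suc (card E0)"
      using e less.prems(1) card.remove[of E e] by (auto simp: E0_def)
    have vE0: "v \<notin> \<Union>E0" using uniq by (auto simp: E0_def)
    have "\<exists>R F. E0 = R \<union> F \<and> forest F \<and> \<Union>R \<inter> \<Union>F = {} \<and> card (\<Union>E0) \<le> card F + card E0"
      by (rule less.hyps) (use E less.prems in auto)
    then obtain R F where RF: "E0 = R \<union> F" "forest F" "\<Union>R \<inter> \<Union>F = {}" "card (\<Union>E0) \<le> card F + card E0"
      by blast
    have finE0: "finite (\<Union>E0)" using fin E by simp
    show ?thesis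
    \<comment> \<open>If \<open>u\<close> lies in \<open>R\<close>, the edge goes to
      \<open>R\<close> and brings one vertex, paid for by \<open>card E\<close>. Otherwise it goes
      to \<open>F\<close> and brings at most two vertices, paid for by \<open>card E\<close> and
      \<open>card F\<close> together.\<close>
    proof (cases "u \<in> \<Union>R")
      case True
      then have "\<Union>E = insert v (\<Union>E0)" using u E RF by auto
      then have "card (\<Union>E) \<le> card F + card E" using RF(4) E vE0 finE0 by simp
      moreover have "\<Union>(insert e R) \<inter> \<Union>F = {}" using True RF vE0 u by auto
      moreover have "E = insert e R \<union> F" using RF E by simp
      ultimately show ?thesis using RF(2) by metis
    next
      case False
      have "\<Union>E = insert v (insert u (\<Union>E0))" using u E by auto
      then have "card (\<Union>E) \<le> Suc (Suc (card (\<Union>E0)))"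
        using finE0 by (simp add: card_insert_if)
      moreover have "e \<notin> F" "finite F" using vE0 RF u forest_finite by auto
      ultimately have "card (\<Union>E) \<le> card (insert e F) + card E" using RF(4) E by simp
      moreover have "forest (insert e F)" unfolding u(1) using RF vE0 u(2) by (intro forest.leaf) auto
      moreover have "\<Union>R \<inter> \<Union>(insert e F) = {}" using False RF vE0 u by auto
      moreover have "E = R \<union> insert e F" using RF E by simp
      ultimately show ?thesis by metis
    qed
  next
    case False
    \<comment> \<open>Incidences are counted twice: each vertex lies on at least two edges and each
      edge has two vertices. Hence the empty forest suffices.\<close>
    have "2 * card (\<Union>E) = (\<Sum>v\<in>\<Union>E. 2)" by simp
    also have "\<dots> \<le> (\<Sum>v\<in>\<Union>E. card {e \<in> E. v \<in> e})"
      using False by (intro sum_mono) force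
    also have "\<dots> = (\<Sum>e\<in>E. card {v \<in> \<Union>E. v \<in> e})"
      using sum.swap_restrict[OF fin less.prems(1), of "\<lambda>_ _. 1::nat" "\<lambda>v e. v \<in> e"] by simp
    also have "\<dots> = (\<Sum>e\<in>E. 2)"
    proof (rule sum.cong[OF refl])
      fix e assume "e \<in> E"
      then have "{v \<in> \<Union>E. v \<in> e} = e" by auto
      then show "card {v \<in> \<Union>E. v \<in> e} = 2" using less.prems(2) \<open>e \<in> E\<close> by simp
    qed
    finally show ?thesis
      by (intro exI[of _ E] exI[of _ "{}"]) (auto intro: forest.empty)
  qed
qed

section \<open>Matchings and stars\<close>

lemma matching_forest:
  assumes "finite M" "\<And>e. e \<in> M \<Longrightarrow> card e = 2" "pairwise disjnt M"
  shows "forest M"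
  using assms
proof (induction rule: finite_induct)
  case (insert e M)
  obtain u v where e: "e = {u, v}" "u \<noteq> v" using insert.prems(1)[of e] by (auto simp: card_2_iff)
  have "v \<notin> \<Union>M"
    using insert.prems(2) insert.hyps(2) e by (fastforce simp: pairwise_insert disjnt_def)
  moreover have "forest M" using insert by (simp add: pairwise_insert)
  ultimately show ?case unfolding e(1) using e(2) by (intro forest.leaf) auto
qed (rule forest.empty)

lemma star_forest:
  assumes "finite I" "a \<notin> I"
  shows "forest ((\<lambda>i. {a, i}) ` I)"
  using assms
proof (induction rule: finite_induct)
  case (insert i I)
  then have "forest (insert {a, i} ((\<lambda>i. {a, i}) ` I))" by (intro forest.leaf) auto
  then show ?case by simp
qed (simp add: forest.empty)

section \<open>Isolated edges and the graphs of bounded genus\<close>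

text \<open>These are the components consisting of a single edge.\<close>

definition isolated_edges :: "'v set set \<Rightarrow> 'v set set" where
  "isolated_edges G = {e \<in> G. \<forall>e'\<in>G. e' \<noteq> e \<longrightarrow> e \<inter> e' = {}}"

lemma finite_labelled_graphs: "finite (labelled_graphs n m)"
proof (rule finite_subset)
  show "labelled_graphs n m \<subseteq> Pow (Pow {1..n})" by (auto simp: labelled_graphs_def)
qed simp

lemma labelled_graphsD:
  assumes "G \<in> labelled_graphs n m"
  shows "finite G" "card G = m" "\<And>e. e \<in> G \<Longrightarrow> e \<subseteq> {1..n}" "\<And>e. e \<in> G \<Longrightarrow> card e = 2"
proof -
  have "G \<subseteq> Pow {1..n}" using assms by (auto simp: labelled_graphs_def)
  then show "finite G" by (rule finite_subset) simp
qed (use assms in \<open>auto simp: labelled_graphs_def\<close>)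

lemma genus_graphsD:
  assumes "G \<in> genus_graphs g n m"
  shows "G \<in> labelled_graphs n m" "genus_at_most g n G"
  using assms by (auto simp: genus_graphs_def)

lemma finite_genus_graphs: "finite (genus_graphs g n m)"
  by (rule finite_subset[OF _ finite_labelled_graphs[of n m]]) (auto simp: genus_graphs_def)

text \<open>A star with centre 1 and \<open>m\<close> leaves is a forest and fits into
  \<open>n\<close> vertices. Nonemptiness gives the uniform distribution its meaning.\<close>

lemma genus_graphs_nonempty:
  assumes "m < n"
  shows "genus_graphs g n m \<noteq> {}"
proof -
  let ?F = "(\<lambda>i. {1, i}) ` {2..m+1} :: nat set set"
  have "inj_on (\<lambda>i. {1, i}) {2..m+1}" by (auto simp: inj_on_def doubleton_eq_iff)
  then have "card ?F = m" by (simp add: card_image)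
  then have "?F \<in> labelled_graphs n m" using assms by (auto simp: labelled_graphs_def)
  moreover have "genus_at_most g n ({} \<union> ?F)"
    using assms by (intro genus_at_most_add_forest genus_at_most_empty star_forest) auto
  ultimately show ?thesis by (auto simp: genus_graphs_def)
qed

section \<open>Lower bounds for the largest face\<close>

text \<open>The forest part of \<open>forest_split\<close> has at least
  \<open>card (\<Union>G) - m\<close> edges, each counted twice in one face; the additive form
  avoids truncated subtraction.\<close>

lemma largest_face_ge_vertices:
  assumes "G \<in> genus_graphs g n m"
  shows "2 * card (\<Union>G) \<le> largest_face g n G + 2 * m"
proof -
  note G = labelled_graphsD[OF genus_graphsD(1)[OF assms]]
  obtain R F where RF: "G = R \<union> F" "forest F" "\<Union>R \<inter> \<Union>F = {}" "card (\<Union>G) \<le> card F + card G"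
    using forest_split[OF G(1,4)] by blast
  have "2 * card F \<le> largest_face g n (R \<union> F)"
  proof (rule genus_at_most_add_forest(2))
    show "genus_at_most g n R"
      using RF(1) by (intro genus_at_most_mono[OF genus_graphsD(2)[OF assms]]) simp
  qed (use RF G in auto)
  then show ?thesis using RF(1,4) G(2) by simp
qed

text \<open>The isolated edges form a matching, hence a forest, and share no vertex with the rest of
  the graph.\<close>

lemma largest_face_ge_isolated_edges:
  assumes "G \<in> genus_graphs g n m"
  shows "2 * card (isolated_edges G) \<le> largest_face g n G"
proof -
  note G = labelled_graphsD[OF genus_graphsD(1)[OF assms]]
  let ?M = "isolated_edges G"
  have M: "?M \<subseteq> G" by (auto simp: isolated_edges_def)
  have "forest ?M"
    using G finite_subset[OF M]
    by (intro matching_forest) (auto simp: isolated_edges_def pairwise_def disjnt_def)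
  moreover have "\<Union>(G - ?M) \<inter> \<Union>?M = {}"
  proof (rule equals0I)
    fix x assume "x \<in> \<Union>(G - ?M) \<inter> \<Union>?M"
    then obtain e f where ef: "x \<in> e" "x \<in> f" "e \<in> ?M" "f \<in> G" "f \<noteq> e" by blast
    then have "e \<inter> f = {}" by (simp add: isolated_edges_def)
    then show False using ef by blast
  qed
  moreover have "genus_at_most g n (G - ?M)"
    by (rule genus_at_most_mono[OF genus_graphsD(2)[OF assms]]) simp
  moreover have "\<Union>?M \<subseteq> {1..n}" using G(3) M by blast
  ultimately have "2 * card ?M \<le> largest_face g n ((G - ?M) \<union> ?M)"
    using G by (intro genus_at_most_add_forest(2)) auto
  then show ?thesis using M by (simp add: Un_absorb2)
qed

section \<open>Moving edges to isolated pairs\<close>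

text \<open>A newly isolated edge is \<open>e\<close> or was kept from being isolated by
  \<open>d\<close>, hence contains \<open>x\<close> or \<open>y\<close>. Isolated edges are
  disjoint, so each of \<open>x\<close> and \<open>y\<close> accounts for at most one.\<close>

lemma card_isolated_edges_switch:
  assumes "finite G" "d = {x, y}"
  shows "card (isolated_edges (insert e (G - {d}))) \<le> card (isolated_edges G) + 3"
proof -
  let ?G = "insert e (G - {d})"
  define A where "A z = {f \<in> isolated_edges ?G. z \<in> f}" for z
  have fin: "finite (isolated_edges ?G)" using assms(1) by (simp add: isolated_edges_def)
  have A: "card (A z) \<le> 1" for z
  proof -
    have "finite (A z)" using fin by (simp add: A_def)
    moreover have "f = f'" if "f \<in> A z" "f' \<in> A z" for f f'
      using that unfolding A_def isolated_edges_def by blast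
    ultimately show ?thesis by (simp add: card_le_Suc0_iff_eq)
  qed
  have "isolated_edges ?G \<subseteq> isolated_edges G \<union> ({e} \<union> (A x \<union> A y))"
    using assms(2) by (auto simp: isolated_edges_def A_def)
  then have "card (isolated_edges ?G) \<le> card (isolated_edges G \<union> ({e} \<union> (A x \<union> A y)))"
    using assms(1) fin by (intro card_mono) (auto simp: A_def isolated_edges_def)
  also have "\<dots> \<le> card (isolated_edges G) + (card {e} + (card (A x) + card (A y)))"
    by (meson add_mono card_Un_le le_refl order_trans)
  finally show ?thesis using A[of x] A[of y] by simp
qed

text \<open>
  Since \<open>card (\<Union>G) \<le> a\<close>, these graphs have at least \<open>n - a\<close> isolated vertices.
\<close>

definition sparse_graphs :: "nat \<Rightarrow> nat \<Rightarrow> nat \<Rightarrow> nat \<Rightarrow> nat \<Rightarrow> nat set set set" where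
  "sparse_graphs g n m a b =
     {G \<in> genus_graphs g n m. card (\<Union>G) \<le> a \<and> card (isolated_edges G) \<le> b}"

lemma finite_sparse_graphs: "finite (sparse_graphs g n m a b)"
  using finite_genus_graphs by (simp add: sparse_graphs_def)

text \<open>Deleting \<open>d\<close> keeps an embedding, and \<open>{e}\<close> is a forest
  disjoint from what remains, so the genus bound survives. The 2 counts the vertices of
  \<open>e\<close>; the 3 comes from \<open>card_isolated_edges_switch\<close>.\<close>

lemma switch_sparse_graphs:
  assumes "G \<in> sparse_graphs g n m a b" "d \<in> G" "e \<subseteq> {1..n} - \<Union>G" "card e = 2"
  shows "insert e (G - {d}) \<in> sparse_graphs g n m (a + 2) (b + 3)"
    and "e \<in> isolated_edges (insert e (G - {d}))"
    and "e \<notin> G"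
proof -
  have GA: "G \<in> genus_graphs g n m" and a: "card (\<Union>G) \<le> a" and b: "card (isolated_edges G) \<le> b"
    using assms(1) by (auto simp: sparse_graphs_def)
  note G = labelled_graphsD[OF genus_graphsD(1)[OF GA]]
  have ne: "e \<noteq> {}" using assms(4) by auto
  show eG: "e \<notin> G" using assms(3) ne by blast
  show "e \<in> isolated_edges (insert e (G - {d}))"
    using assms(3) by (auto simp: isolated_edges_def)
  have "card (insert e (G - {d})) = Suc (card (G - {d}))" using G(1) eG by simp
  then have "card (insert e (G - {d})) = m"
    using card.remove[OF G(1) assms(2)] G(2) by simp
  then have "insert e (G - {d}) \<in> labelled_graphs n m"
    using G assms(3,4) by (auto simp: labelled_graphs_def)
  moreover have "genus_at_most g n ((G - {d}) \<union> {e})"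
  proof (rule genus_at_most_add_forest)
    show "genus_at_most g n (G - {d})"
      by (rule genus_at_most_mono[OF genus_graphsD(2)[OF GA]]) auto
    show "forest {e}" using assms(4) by (intro matching_forest) auto
  qed (use G assms(3) in auto)
  ultimately have "insert e (G - {d}) \<in> genus_graphs g n m" by (simp add: genus_graphs_def)
  moreover have "card (\<Union>(insert e (G - {d}))) \<le> a + 2"
  proof -
    have "finite (\<Union>G)" using G by (meson finite_Union finite_atLeastAtMost finite_subset)
    moreover have "finite e" using assms(4) by (simp add: card_ge_0_finite)
    ultimately have "card (\<Union>(insert e (G - {d}))) \<le> card (\<Union>G \<union> e)" by (intro card_mono) auto
    also have "\<dots> \<le> a + 2" using card_Un_le[of "\<Union>G" e] a assms(4) by simp
    finally show ?thesis .
  qed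
  moreover have "card (isolated_edges (insert e (G - {d}))) \<le> b + 3"
  proof -
    obtain x y where "d = {x, y}" using G(4)[OF assms(2)] by (auto simp: card_2_iff)
    then show ?thesis using card_isolated_edges_switch[OF G(1), of d x y e] b by simp
  qed
  ultimately show "insert e (G - {d}) \<in> sparse_graphs g n m (a + 2) (b + 3)"
    by (simp add: sparse_graphs_def)
qed

text \<open>
  Move an edge \<open>d\<close> of \<open>G\<close> to a pair \<open>e\<close> of isolated vertices. The resulting graph together with
  \<open>e\<close> and \<open>d\<close> determines \<open>G\<close>, and \<open>e\<close> is one of its few isolated edges.
\<close>

lemma switching_count:
  "card (sparse_graphs g n m a b) * (m * ((n - a) choose 2)) \<le>
   card (sparse_graphs g n m (a + 2) (b + 3)) * ((b + 3) * (n choose 2))"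
proof -
  let ?B = "sparse_graphs g n m a b" and ?B' = "sparse_graphs g n m (a + 2) (b + 3)"
  let ?P = "\<lambda>S. {e :: nat set. e \<subseteq> S \<and> card e = 2}"
  let ?T = "SIGMA G:?B. G \<times> ?P ({1..n} - \<Union>G)"
  \<comment> \<open>To undo a switch, \<open>e\<close> is sought among at most \<open>b + 3\<close>
    isolated edges and \<open>d\<close> among all pairs.\<close>
  let ?T' = "SIGMA G:?B'. isolated_edges G \<times> ?P {1..n}"
  have BG: "finite G" "card G = m" "\<Union>G \<subseteq> {1..n}" "\<And>e. e \<in> G \<Longrightarrow> card e = 2"
    "card (\<Union>G) \<le> a" "card (isolated_edges G) \<le> b"
    if "G \<in> sparse_graphs g n m a b" for G a b
  proof -
    have "G \<in> labelled_graphs n m"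
      using that by (simp add: sparse_graphs_def genus_graphs_def)
    note G = labelled_graphsD[OF this]
    show "finite G" "card G = m" "\<And>e. e \<in> G \<Longrightarrow> card e = 2" using G(1,2,4) .
    show "\<Union>G \<subseteq> {1..n}" using G(3) by blast
    show "card (\<Union>G) \<le> a" "card (isolated_edges G) \<le> b"
      using that by (simp_all add: sparse_graphs_def)
  qed
  have "card ?B * (m * ((n - a) choose 2)) = (\<Sum>G\<in>?B. m * ((n - a) choose 2))" by simp
  also have "\<dots> \<le> (\<Sum>G\<in>?B. card (G \<times> ?P ({1..n} - \<Union>G)))"
  proof (rule sum_mono)
    fix G assume G: "G \<in> ?B"
    have "finite (\<Union>G)" using BG(3)[OF G] finite_subset by blast
    then have "n - a \<le> card ({1..n} - \<Union>G)"
      using BG[OF G] by (simp add: card_Diff_subset)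
    then have "(n - a) choose 2 \<le> card (?P ({1..n} - \<Union>G))"
      by (simp add: n_subsets binomial_right_mono)
    then show "m * ((n - a) choose 2) \<le> card (G \<times> ?P ({1..n} - \<Union>G))"
      using BG(2)[OF G] by (simp add: card_cartesian_product)
  qed
  also have "\<dots> = card ?T"
    using BG(1) by (intro card_SigmaI[symmetric] finite_sparse_graphs) auto
  also have "\<dots> \<le> card ?T'"
  proof (rule card_inj_on_le)
    let ?f = "\<lambda>(G, d, e). (insert e (G - {d}), e, d)"
    show "inj_on ?f ?T"
    proof (rule inj_onI)
      fix s t assume st: "s \<in> ?T" "t \<in> ?T" "?f s = ?f t"
      obtain G d e where s: "s = (G, d, e)" by (cases s)
      obtain H where t: "t = (H, d, e)" using st(3) by (cases t) (simp add: s)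
      have G: "G \<in> ?B" "d \<in> G" "e \<subseteq> {1..n} - \<Union>G" "card e = 2"
        using st(1) unfolding s by simp_all
      have H: "H \<in> ?B" "d \<in> H" "e \<subseteq> {1..n} - \<Union>H"
        using st(2) unfolding t by simp_all
      have eq: "insert e (G - {d}) = insert e (H - {d})" using st(3) by (simp add: s t)
      have "e \<notin> G" "e \<notin> H" using switch_sparse_graphs(3)[OF G] switch_sparse_graphs(3)[OF H G(4)] by auto
      then have "G - {d} = H - {d}" using eq by (metis Diff_iff insert_ident)
      then have "G = H" using G(2) H(2) by (metis insert_Diff)
      then show "s = t" by (simp add: s t)
    qed
    show "?f ` ?T \<subseteq> ?T'"
    proof (rule image_subsetI)
      fix s assume st: "s \<in> ?T"
      obtain G d e where s: "s = (G, d, e)" by (cases s)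
      have G: "G \<in> ?B" "d \<in> G" "e \<subseteq> {1..n} - \<Union>G" "card e = 2"
        using st unfolding s by simp_all
      have "d \<subseteq> {1..n}" "card d = 2" using BG(3,4)[OF G(1)] G(2) by blast+
      then show "?f s \<in> ?T'"
        using switch_sparse_graphs(1,2)[OF G] by (simp add: s)
    qed
    show "finite ?T'"
      using BG(1) finite_sparse_graphs by (intro finite_SigmaI) (auto simp: isolated_edges_def)
  qed
  also have "\<dots> = (\<Sum>G\<in>?B'. card (isolated_edges G \<times> ?P {1..n}))"
    using BG(1) by (intro card_SigmaI finite_sparse_graphs) (auto simp: isolated_edges_def)
  also have "\<dots> \<le> (\<Sum>G\<in>?B'. (b + 3) * (n choose 2))"
    using BG(6) by (intro sum_mono) (simp add: card_cartesian_product n_subsets)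
  finally show ?thesis by simp
qed

section \<open>The typical size of the largest face\<close>

lemma real_choose_two: "real (k choose 2) = real k * (real k - 1) / 2"
  by (cases k) (auto simp: binomial_gbinomial gbinomial_prod_rev numeral_2_eq_2 field_simps)

text \<open>A graph has at least \<open>\<delta> ^ 3 * n ^ 3 / 64\<close> switches, and at most
  \<open>\<delta> ^ 3 * n ^ 3 / 128\<close> switches lead to the same graph. The constant 256 is
  chosen to produce this ratio 2.\<close>

lemma sparse_graphs_double:
  assumes \<delta>: "0 < \<delta>" and m: "\<delta> * real n \<le> real m"
    and a: "real a + \<delta> / 4 * real n \<le> real n" and n: "8 \<le> \<delta> * real n"
    and b: "real b + 3 \<le> 4 * (\<delta> ^ 3 / 256) * real n"
  shows "2 * card (sparse_graphs g n m a b) \<le> card (sparse_graphs g n m (a + 2) (b + 3))"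
proof -
  let ?S = "real (card (sparse_graphs g n m a b))"
  let ?S' = "real (card (sparse_graphs g n m (a + 2) (b + 3)))"
  define y where "y = \<delta> / 4 * real n"
  have "a \<le> n" using a n by linarith
  have "y \<ge> 2" using n by (simp add: y_def)
  have x: "y \<le> real (n - a)" using a \<open>a \<le> n\<close> by (simp add: y_def of_nat_diff)
  \<comment> \<open>As \<open>y \<ge> 2\<close>, subtracting 1 leaves at least
    \<open>y / 2\<close>.\<close>
  have "y * (y / 2) \<le> real (n - a) * (real (n - a) - 1)"
    using x \<open>y \<ge> 2\<close> by (intro mult_mono) auto
  then have "y ^ 2 / 4 \<le> real ((n - a) choose 2)"
    by (simp add: real_choose_two power2_eq_square)
  then have "\<delta> * real n * (y ^ 2 / 4) \<le> real m * real ((n - a) choose 2)"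
    using m by (intro mult_mono) auto
  then have "?S * (\<delta> ^ 3 * real n ^ 3 / 64) \<le> ?S * (real m * real ((n - a) choose 2))"
    by (intro mult_left_mono) (auto simp: y_def power2_eq_square power3_eq_cube field_simps)
  also have "\<dots> \<le> ?S' * (real (b + 3) * real (n choose 2))"
    using switching_count[of g n m a b] by (metis of_nat_le_iff of_nat_mult)
  also have "\<dots> \<le> ?S' * (4 * (\<delta> ^ 3 / 256) * real n * (real n ^ 2 / 2))"
  proof (intro mult_left_mono mult_mono)
    show "real (n choose 2) \<le> real n ^ 2 / 2"
      by (simp add: real_choose_two power2_eq_square algebra_simps)
  qed (use b \<delta> in auto)
  finally have "(2 * ?S) * (\<delta> ^ 3 * real n ^ 3) \<le> ?S' * (\<delta> ^ 3 * real n ^ 3)"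
    by (simp add: power2_eq_square power3_eq_cube field_simps)
  moreover have "0 < \<delta> ^ 3 * real n ^ 3"
  proof -
    have "n \<noteq> 0" using n by (intro notI) simp
    then show ?thesis using \<delta> by simp
  qed
  ultimately have "2 * ?S \<le> ?S'" by (simp only: mult_le_cancel_right_pos)
  then show ?thesis by linarith
qed

text \<open>\<open>sparse_graphs_double\<close> is applied \<open>k\<close> times. Before move
  \<open>j + 1\<close> the bounds are \<open>a + 2 * j\<close> and \<open>k + 3 * j\<close>, and
  \<open>k + 3 * j + 3 \<le> 4 * k\<close> explains the factor 4 in its hypothesis.\<close>

lemma sparse_graphs_rare:
  assumes \<delta>: "0 < \<delta>" "\<delta> \<le> 1" and m: "\<delta> * real n \<le> real m" and n: "8 \<le> \<delta> * real n"
    and a: "real a \<le> real n - \<delta> * real n / 2" and k: "real k \<le> \<delta> ^ 3 / 256 * real n"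
  shows "2 ^ k * card (sparse_graphs g n m a k) \<le> card (genus_graphs g n m)"
proof -
  have "2 ^ j * card (sparse_graphs g n m a k) \<le> card (sparse_graphs g n m (a + 2 * j) (k + 3 * j))"
    if "j \<le> k" for j
    using that
  proof (induction j)
    case (Suc j)
    \<comment> \<open>Thus \<open>2 * j\<close> is at most \<open>\<delta> * n / 128\<close>, and of
      the \<open>\<delta> * n / 2\<close> isolated vertices at least \<open>\<delta> * n / 4\<close>
      remain.\<close>
    have "\<delta> ^ 3 \<le> \<delta>" using \<delta> by (simp add: power_le_one power3_eq_cube mult_le_one mult_left_le)
    then have "\<delta> ^ 3 / 256 * real n \<le> \<delta> * real n / 256"
      using mult_right_mono[of "\<delta> ^ 3" \<delta> "real n"] by simp
    then have "real k \<le> \<delta> * real n / 256" using k by linarith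
    moreover have "real j + 1 \<le> real k" using Suc.prems by simp
    ultimately have "real (a + 2 * j) + \<delta> / 4 * real n \<le> real n"
      using a n by simp
    moreover have "real (k + 3 * j) + 3 \<le> 4 * (\<delta> ^ 3 / 256) * real n"
      using k \<open>real j + 1 \<le> real k\<close> by (simp add: algebra_simps)
    ultimately have "2 * card (sparse_graphs g n m (a + 2 * j) (k + 3 * j)) \<le>
        card (sparse_graphs g n m (a + 2 * j + 2) (k + 3 * j + 3))"
      using \<delta> m n by (intro sparse_graphs_double)
    then show ?case using Suc by (simp add: algebra_simps)
  qed simp
  from this[of k] have "2 ^ k * card (sparse_graphs g n m a k) \<le>
      card (sparse_graphs g n m (a + 2 * k) (k + 3 * k))" by simp
  also have "\<dots> \<le> card (genus_graphs g n m)"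
    by (intro card_mono finite_genus_graphs) (auto simp: sparse_graphs_def)
  finally show ?thesis .
qed

text \<open>Outside \<open>sparse_graphs\<close> one of the two lower bounds for the largest face
  applies, and the sparse graphs are at most a fraction \<open>(1/2) ^ k\<close> of all.\<close>

lemma prob_largest_face_ge:
  assumes \<delta>: "0 < \<delta>" "\<delta> \<le> 1" and m: "\<delta> * real n \<le> real m" "real m \<le> (1 - \<delta>) * real n"
    and n: "8 \<le> \<delta> * real n"
  defines "c \<equiv> \<delta> ^ 3 / 256"
  shows "1 - (1/2) ^ nat \<lfloor>c * real n\<rfloor> \<le> measure_pmf.prob (pmf_of_set (genus_graphs g n m))
    {G. c * real n \<le> real (largest_face g n G) \<and> real (largest_face g n G) \<le> 2 * real n}"
proof -
  let ?A = "genus_graphs g n m"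
  define S where "S = {G. c * real n \<le> real (largest_face g n G) \<and> real (largest_face g n G) \<le> 2 * real n}"
  define k where "k = nat \<lfloor>c * real n\<rfloor>"
  define a where "a = nat \<lfloor>real n - \<delta> * real n / 2\<rfloor>"
  let ?B = "sparse_graphs g n m a k"
  have c: "0 < c" "c \<le> \<delta>"
    using \<delta> power_decreasing[of 1 3 \<delta>] by (auto simp: c_def)
  have n0: "0 < real n" using n by (cases n) auto
  have "0 \<le> real n - \<delta> * real n / 2"
    using \<delta> mult_right_mono[of \<delta> 1 "real n"] by simp
  then have a: "real a \<le> real n - \<delta> * real n / 2" by (simp add: a_def)
  have k: "real k \<le> c * real n" using c by (simp add: k_def)
  have mn: "real m < real n"
  proof -
    have "(1 - \<delta>) * real n < 1 * real n" using \<delta> n0 by (intro mult_strict_right_mono) auto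
    then show ?thesis using m by simp
  qed
  have good: "G \<in> S" if G: "G \<in> ?A" "G \<notin> ?B" for G
  proof -
    note GL = labelled_graphsD[OF genus_graphsD(1)[OF G(1)]]
    have "largest_face g n G \<le> 2 * m"
      using largest_face_le[OF genus_graphsD(2)[OF G(1)] GL(1,3)] GL(2) by simp
    moreover have "c * real n \<le> real (largest_face g n G)"
    proof (rule ccontr)
      assume less: "\<not> c * real n \<le> real (largest_face g n G)"
      \<comment> \<open>A face below \<open>c * n \<le> \<delta> * n\<close> together with
        \<open>m \<le> (1 - \<delta>) * n\<close> forces at least \<open>\<delta> * n / 2\<close>
        isolated vertices.\<close>
      have "2 * real (card (\<Union>G)) \<le> real (largest_face g n G) + 2 * real m"
        using largest_face_ge_vertices[OF G(1)] by linarith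
      also have "\<dots> \<le> \<delta> * real n + 2 * ((1 - \<delta>) * real n)"
        using less m(2) mult_right_mono[OF c(2), of "real n"] by linarith
      finally have "real (card (\<Union>G)) \<le> real n - \<delta> * real n / 2" by (simp add: algebra_simps)
      then have "card (\<Union>G) \<le> a" by (simp add: a_def le_nat_floor)
      moreover have "real (card (isolated_edges G)) \<le> c * real n"
        using largest_face_ge_isolated_edges[OF G(1)] less by linarith
      then have "card (isolated_edges G) \<le> k" by (simp add: k_def le_nat_floor)
      ultimately show False using G by (simp add: sparse_graphs_def)
    qed
    ultimately show ?thesis using mn by (simp add: S_def)
  qed
  have ne: "?A \<noteq> {}" using mn by (intro genus_graphs_nonempty) simp
  then have pos: "0 < real (card ?A)" using finite_genus_graphs by (simp add: card_gt_0_iff)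
  have "2 ^ k * card ?B \<le> card ?A"
    using \<delta> m(1) n a k by (intro sparse_graphs_rare) (simp_all add: c_def)
  from of_nat_mono[OF this, where 'a = real]
  have "2 ^ k * real (card ?B) \<le> real (card ?A)" by simp
  then have B: "real (card ?B) \<le> (1/2) ^ k * real (card ?A)"
    by (simp add: power_one_over field_simps)
  have "card ?A \<le> card ((?A \<inter> S) \<union> ?B)"
  proof (rule card_mono)
    show "?A \<subseteq> (?A \<inter> S) \<union> ?B" using good by blast
  qed (simp add: finite_genus_graphs finite_sparse_graphs)
  then have "card ?A \<le> card (?A \<inter> S) + card ?B" by (rule order_trans[OF _ card_Un_le])
  then have "real (card ?A) \<le> real (card (?A \<inter> S)) + real (card ?B)" by linarith
  then have "(1 - (1/2) ^ k) * real (card ?A) \<le> real (card (?A \<inter> S))"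
    using B by (simp add: algebra_simps)
  then show ?thesis
    using pos by (simp add: measure_pmf_of_set[OF ne finite_genus_graphs] pos_le_divide_eq
        flip: S_def k_def)
qed

theorem theorem6p1:
  fixes g :: nat and m :: "nat \<Rightarrow> nat"
  assumes "0 < liminf (\<lambda>n. ereal (real (m n) / real n))"
    and "limsup (\<lambda>n. ereal (real (m n) / real n)) < 1"
  shows "\<exists>c C :: real. 0 < c \<and> c \<le> C \<and>
    (\<lambda>n. measure_pmf.prob (pmf_of_set (genus_graphs g n (m n)))
       {G. c * real n \<le> real (largest_face g n G) \<and> real (largest_face g n G) \<le> C * real n})
    \<longlonglongrightarrow> 1"
proof -
  obtain \<alpha> where \<alpha>: "0 < \<alpha>" "ereal \<alpha> < liminf (\<lambda>n. ereal (real (m n) / real n))"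
    using ereal_dense2[OF assms(1)] by auto
  obtain \<beta> where \<beta>: "\<beta> < 1" "limsup (\<lambda>n. ereal (real (m n) / real n)) < ereal \<beta>"
    using ereal_dense2[OF assms(2)] by auto
  \<comment> \<open>One constant serves for both density bounds, \<open>\<delta> * n \<le> m\<close>
    and \<open>m \<le> (1 - \<delta>) * n\<close>.\<close>
  define \<delta> where "\<delta> = min 1 (min \<alpha> (1 - \<beta>))"
  have \<delta>: "0 < \<delta>" "\<delta> \<le> 1" "\<delta> \<le> \<alpha>" "\<beta> \<le> 1 - \<delta>" using \<alpha> \<beta> by (auto simp: \<delta>_def)
  define c where "c = \<delta> ^ 3 / 256"
  \<comment> \<open>The upper constant is 2, since a face has size at most \<open>2 * m\<close> and
    \<open>m < n\<close> eventually.\<close>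
  have c: "0 < c" "c \<le> 2" using \<delta> power_le_one[of \<delta> 3] by (auto simp: c_def)
  let ?P = "\<lambda>n. measure_pmf.prob (pmf_of_set (genus_graphs g n (m n)))
    {G. c * real n \<le> real (largest_face g n G) \<and> real (largest_face g n G) \<le> 2 * real n}"
  have "eventually (\<lambda>n. ereal \<alpha> < ereal (real (m n) / real n)) sequentially"
    using \<alpha>(2) by (rule less_LiminfD)
  moreover have "eventually (\<lambda>n. ereal (real (m n) / real n) < ereal \<beta>) sequentially"
    using \<beta>(2) by (rule Limsup_lessD)
  moreover have "eventually (\<lambda>n. n \<ge> nat \<lceil>8 / \<delta>\<rceil>) sequentially" by (rule eventually_ge_at_top)
  ultimately have lower: "eventually (\<lambda>n. 1 - (1/2) ^ nat \<lfloor>c * real n\<rfloor> \<le> ?P n) sequentially"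
  proof eventually_elim
    case (elim n)
    then have n: "8 \<le> \<delta> * real n" using \<delta>(1) by (simp add: nat_le_iff ceiling_le_iff field_simps)
    then have n0: "0 < real n" by (cases n) auto
    have "\<alpha> * real n \<le> real (m n)" "real (m n) \<le> \<beta> * real n"
      using elim n0 by (simp_all add: field_simps)
    then have "\<delta> * real n \<le> real (m n)" "real (m n) \<le> (1 - \<delta>) * real n"
      using \<delta>(3,4) n0 by (meson mult_right_mono order_trans less_imp_le)+
    then show ?case
      unfolding c_def using \<delta> n by (intro prob_largest_face_ge)
  qed
  have limit: "(\<lambda>n. 1 - (1/2) ^ nat \<lfloor>c * real n\<rfloor> :: real) \<longlonglongrightarrow> 1"
  proof -
    have "filterlim (\<lambda>n. c * real n) at_top sequentially"
      by (rule filterlim_tendsto_pos_mult_at_top[OF tendsto_const c(1) filterlim_real_sequentially])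
    then have "filterlim (\<lambda>n. nat \<lfloor>c * real n\<rfloor>) sequentially sequentially"
      by (intro filterlim_compose[OF filterlim_nat_sequentially] filterlim_compose[OF filterlim_floor_sequentially])
    then have "(\<lambda>n. (1/2) ^ nat \<lfloor>c * real n\<rfloor> :: real) \<longlonglongrightarrow> 0"
      by (rule filterlim_compose[OF LIMSEQ_realpow_zero, rotated 2]) auto
    then show ?thesis using tendsto_diff[OF tendsto_const, of _ "0::real" sequentially 1] by simp
  qed
  have "?P \<longlonglongrightarrow> 1"
    by (rule tendsto_sandwich[OF lower _ limit tendsto_const]) simp
  with c show ?thesis by (intro exI[of _ c] exI[of _ 2] conjI)
qed

end
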